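(* Let $E$ be a connected graded Frobenius algebra whose Nakayama automorphism $\mu_E$ restricts to a scalar multiplication on $E_1$. Let $K$ be a Hopf algebra with antipode $S$ such that $E$ is a left $K$-comodule algebra with grading-preserving coaction, the coaction on $E_1$ is inner-faithful, and the homological codeterminant is trivial. Then $S^2=\mathrm{Id}_K$. If in addition $K$ is finite dimensional and $\mathrm{char}\,k$ does not divide $\dim K$, then $H=K^\circ$ is semisimple.
   Context: A connected graded algebra $E$ is Frobenius if it is finite dimensional with a nondegenerate associative graded bilinear form $\langle-,-\rangle$; its Nakayama automorphism $\mu_E$ satisfies $\langle a,b\rangle=\langle b,\mu_E(a)\rangle$. The top nonzero degree of $E$ is one-dimensional, spanned by $\mathfrak e$; the homological codeterminant is the grouplike ${\sf D}\in K$ with $\rho(\mathfrak e)={\sf D}\otimes\mathfrak e$, and it is trivial if ${\sf D}=1_K$. Inner-faithful on $E_1$: $\rho(E_1)\not\subseteq K'\otimes E_1$ for every proper Hopf subalgebra $K'\subsetneq K$. $K^\circ$ is the Hopf dual. *)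

theory Defs
  imports Complex_Main
begin

(* Tensors V (x) W over a field k are represented by finite lists of pairs
   (sums of pure tensors).  Two lists represent the same tensor iff they agree
   under all pairs of linear functionals (the canonical map
   V (x) W -> (V* (x) W* )* is injective over a field). *)

definition lin_fun :: "('k::field \<Rightarrow> 'v::ab_group_add \<Rightarrow> 'v) \<Rightarrow> ('v \<Rightarrow> 'k) \<Rightarrow> bool" where
  "lin_fun s f \<longleftrightarrow> (\<forall>x y. f (x + y) = f x + f y) \<and> (\<forall>c x. f (s c x) = c * f x)"

definition lin_map :: "('k::field \<Rightarrow> 'v::ab_group_add \<Rightarrow> 'v) \<Rightarrow> ('k \<Rightarrow> 'w::ab_group_add \<Rightarrow> 'w)
    \<Rightarrow> ('v \<Rightarrow> 'w) \<Rightarrow> bool" where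
  "lin_map s t f \<longleftrightarrow> (\<forall>x y. f (x + y) = f x + f y) \<and> (\<forall>c x. f (s c x) = t c (f x))"

definition teval :: "('a \<times> 'b) list \<Rightarrow> ('a \<Rightarrow> 'k::field) \<Rightarrow> ('b \<Rightarrow> 'k) \<Rightarrow> 'k" where
  "teval xs f g = (\<Sum>(a, b)\<leftarrow>xs. f a * g b)"

definition teq :: "('k::field \<Rightarrow> 'a::ab_group_add \<Rightarrow> 'a) \<Rightarrow> ('k \<Rightarrow> 'b::ab_group_add \<Rightarrow> 'b)
    \<Rightarrow> ('a \<times> 'b) list \<Rightarrow> ('a \<times> 'b) list \<Rightarrow> bool" where
  "teq sA sB xs ys \<longleftrightarrow>
     (\<forall>f g. lin_fun sA f \<longrightarrow> lin_fun sB g \<longrightarrow> teval xs f g = teval ys f g)"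

definition tin :: "('k::field \<Rightarrow> 'a::ab_group_add \<Rightarrow> 'a) \<Rightarrow> ('k \<Rightarrow> 'b::ab_group_add \<Rightarrow> 'b)
    \<Rightarrow> ('a \<times> 'b) list \<Rightarrow> 'a set \<Rightarrow> 'b set \<Rightarrow> bool" where
  "tin sA sB xs A B \<longleftrightarrow> (\<exists>ys. set ys \<subseteq> A \<times> B \<and> teq sA sB xs ys)"

definition k_algebra :: "('k::field \<Rightarrow> 'a::ring_1 \<Rightarrow> 'a) \<Rightarrow> bool" where
  "k_algebra s \<longleftrightarrow> vector_space s \<and>
     (\<forall>c a b. s c (a * b) = s c a * b \<and> s c (a * b) = a * s c b)"

definition hopf_algebra :: "('k::field \<Rightarrow> 'K::ring_1 \<Rightarrow> 'K) \<Rightarrow> ('K \<Rightarrow> ('K \<times> 'K) list)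
    \<Rightarrow> ('K \<Rightarrow> 'k) \<Rightarrow> ('K \<Rightarrow> 'K) \<Rightarrow> bool" where
  "hopf_algebra s \<Delta> \<epsilon> S \<longleftrightarrow>
     k_algebra s \<and>
     \<comment> \<open>comultiplication is linear\<close>
     (\<forall>c x y. teq s s (\<Delta> (s c x + y)) (map (\<lambda>(a, b). (s c a, b)) (\<Delta> x) @ \<Delta> y)) \<and>
     \<comment> \<open>coassociativity\<close>
     (\<forall>x f g h. lin_fun s f \<longrightarrow> lin_fun s g \<longrightarrow> lin_fun s h \<longrightarrow>
        (\<Sum>(a, b)\<leftarrow>\<Delta> x. teval (\<Delta> a) f g * h b) = (\<Sum>(a, b)\<leftarrow>\<Delta> x. f a * teval (\<Delta> b) g h)) \<and>
     \<comment> \<open>counit\<close>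
     lin_fun s \<epsilon> \<and>
     (\<forall>x. (\<Sum>(a, b)\<leftarrow>\<Delta> x. s (\<epsilon> b) a) = x \<and> (\<Sum>(a, b)\<leftarrow>\<Delta> x. s (\<epsilon> a) b) = x) \<and>
     \<comment> \<open>comultiplication and counit are algebra maps\<close>
     (\<forall>x y. teq s s (\<Delta> (x * y)) [(a * c, b * d). (a, b) \<leftarrow> \<Delta> x, (c, d) \<leftarrow> \<Delta> y]) \<and>
     teq s s (\<Delta> 1) [(1, 1)] \<and>
     (\<forall>x y. \<epsilon> (x * y) = \<epsilon> x * \<epsilon> y) \<and> \<epsilon> 1 = 1 \<and>
     \<comment> \<open>antipode\<close>
     lin_map s s S \<and>
     (\<forall>x. (\<Sum>(a, b)\<leftarrow>\<Delta> x. S a * b) = s (\<epsilon> x) 1 \<and> (\<Sum>(a, b)\<leftarrow>\<Delta> x. a * S b) = s (\<epsilon> x) 1)"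

definition hopf_subalgebra :: "('k::field \<Rightarrow> 'K::ring_1 \<Rightarrow> 'K) \<Rightarrow> ('K \<Rightarrow> ('K \<times> 'K) list)
    \<Rightarrow> ('K \<Rightarrow> 'K) \<Rightarrow> 'K set \<Rightarrow> bool" where
  "hopf_subalgebra s \<Delta> S K' \<longleftrightarrow>
     module.subspace s K' \<and> 1 \<in> K' \<and> (\<forall>x\<in>K'. \<forall>y\<in>K'. x * y \<in> K') \<and>
     (\<forall>x\<in>K'. tin s s (\<Delta> x) K' K') \<and> S ` K' \<subseteq> K'"

definition connected_graded :: "('k::field \<Rightarrow> 'E::ring_1 \<Rightarrow> 'E) \<Rightarrow> (nat \<Rightarrow> 'E set) \<Rightarrow> bool" where
  "connected_graded s gr \<longleftrightarrow>
     k_algebra s \<and> (\<forall>i. module.subspace s (gr i)) \<and>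
     (\<forall>x. \<exists>!c. (\<forall>i. c i \<in> gr i) \<and> finite {i. c i \<noteq> 0} \<and> x = sum c {i. c i \<noteq> 0}) \<and>
     (\<forall>i j a b. a \<in> gr i \<longrightarrow> b \<in> gr j \<longrightarrow> a * b \<in> gr (i + j)) \<and>
     gr 0 = range (\<lambda>c. s c 1)"

definition frobenius_form :: "('k::field \<Rightarrow> 'E::ring_1 \<Rightarrow> 'E) \<Rightarrow> (nat \<Rightarrow> 'E set)
    \<Rightarrow> ('E \<Rightarrow> 'E \<Rightarrow> 'k) \<Rightarrow> bool" where
  "frobenius_form s gr B \<longleftrightarrow>
     (\<exists>Bas. finite_dimensional_vector_space s Bas) \<and>
     (\<forall>a. lin_fun s (B a)) \<and> (\<forall>b. lin_fun s (\<lambda>a. B a b)) \<and>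
     (\<forall>a b c. B (a * b) c = B a (b * c)) \<and>
     (\<forall>a. (\<forall>b. B a b = 0) \<longrightarrow> a = 0) \<and> (\<forall>b. (\<forall>a. B a b = 0) \<longrightarrow> b = 0) \<and>
     (\<exists>d. \<forall>i j a b. a \<in> gr i \<longrightarrow> b \<in> gr j \<longrightarrow> i + j \<noteq> d \<longrightarrow> B a b = 0)"

definition nakayama :: "('E \<Rightarrow> 'E \<Rightarrow> 'k) \<Rightarrow> ('E \<Rightarrow> 'E) \<Rightarrow> bool" where
  "nakayama B \<mu> \<longleftrightarrow> (\<forall>a b. B a b = B b (\<mu> a))"

definition graded_comodule_algebra :: "('k::field \<Rightarrow> 'K::ring_1 \<Rightarrow> 'K) \<Rightarrow> ('K \<Rightarrow> ('K \<times> 'K) list)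
    \<Rightarrow> ('K \<Rightarrow> 'k) \<Rightarrow> ('k \<Rightarrow> 'E::ring_1 \<Rightarrow> 'E) \<Rightarrow> (nat \<Rightarrow> 'E set) \<Rightarrow> ('E \<Rightarrow> ('K \<times> 'E) list) \<Rightarrow> bool" where
  "graded_comodule_algebra sK \<Delta> \<epsilon> sE gr \<rho> \<longleftrightarrow>
     (\<forall>c x y. teq sK sE (\<rho> (sE c x + y)) (map (\<lambda>(a, e). (sK c a, e)) (\<rho> x) @ \<rho> y)) \<and>
     (\<forall>x f g h. lin_fun sK f \<longrightarrow> lin_fun sK g \<longrightarrow> lin_fun sE h \<longrightarrow>
        (\<Sum>(a, e)\<leftarrow>\<rho> x. f a * teval (\<rho> e) g h) = (\<Sum>(a, e)\<leftarrow>\<rho> x. teval (\<Delta> a) f g * h e)) \<and>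
     (\<forall>x. (\<Sum>(a, e)\<leftarrow>\<rho> x. sE (\<epsilon> a) e) = x) \<and>
     (\<forall>x y. teq sK sE (\<rho> (x * y)) [(a * b, e * e'). (a, e) \<leftarrow> \<rho> x, (b, e') \<leftarrow> \<rho> y]) \<and>
     teq sK sE (\<rho> 1) [(1, 1)] \<and>
     (\<forall>i. \<forall>x\<in>gr i. tin sK sE (\<rho> x) UNIV (gr i))"

definition inner_faithful_on :: "('k::field \<Rightarrow> 'K::ring_1 \<Rightarrow> 'K) \<Rightarrow> ('K \<Rightarrow> ('K \<times> 'K) list)
    \<Rightarrow> ('K \<Rightarrow> 'K) \<Rightarrow> ('k \<Rightarrow> 'E::ring_1 \<Rightarrow> 'E) \<Rightarrow> ('E \<Rightarrow> ('K \<times> 'E) list) \<Rightarrow> 'E set \<Rightarrow> bool" where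
  "inner_faithful_on sK \<Delta> S sE \<rho> V \<longleftrightarrow>
     (\<forall>K'. hopf_subalgebra sK \<Delta> S K' \<and> K' \<noteq> UNIV \<longrightarrow> \<not> (\<forall>x\<in>V. tin sK sE (\<rho> x) K' V))"

definition top_degree :: "(nat \<Rightarrow> 'E::zero set) \<Rightarrow> nat \<Rightarrow> bool" where
  "top_degree gr d \<longleftrightarrow> gr d \<noteq> {0} \<and> (\<forall>j>d. gr j = {0})"

definition hom_codeterminant :: "('k::field \<Rightarrow> 'K::ring_1 \<Rightarrow> 'K) \<Rightarrow> ('k \<Rightarrow> 'E::ring_1 \<Rightarrow> 'E)
    \<Rightarrow> (nat \<Rightarrow> 'E set) \<Rightarrow> ('E \<Rightarrow> ('K \<times> 'E) list) \<Rightarrow> 'K \<Rightarrow> bool" where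
  "hom_codeterminant sK sE gr \<rho> D \<longleftrightarrow>
     (\<exists>d. top_degree gr d \<and> (\<forall>e\<in>gr d. teq sK sE (\<rho> e) [(D, e)]))"

definition codeterminant_trivial where
  "codeterminant_trivial sK sE gr \<rho> \<longleftrightarrow> hom_codeterminant sK sE gr \<rho> 1"

(* For finite-dimensional K, the Hopf dual K\<degree> is the full dual K* with the
   convolution product; semisimple = every left ideal is a direct summand. *)
definition dual_elems :: "('k::field \<Rightarrow> 'K::ring_1 \<Rightarrow> 'K) \<Rightarrow> ('K \<Rightarrow> 'k) set" where
  "dual_elems s = {f. lin_fun s f}"

definition conv :: "('K \<Rightarrow> ('K \<times> 'K) list) \<Rightarrow> ('K \<Rightarrow> 'k::field) \<Rightarrow> ('K \<Rightarrow> 'k) \<Rightarrow> 'K \<Rightarrow> 'k" where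
  "conv \<Delta> f g = (\<lambda>x. teval (\<Delta> x) f g)"

definition dual_left_ideal :: "('k::field \<Rightarrow> 'K::ring_1 \<Rightarrow> 'K) \<Rightarrow> ('K \<Rightarrow> ('K \<times> 'K) list)
    \<Rightarrow> ('K \<Rightarrow> 'k) set \<Rightarrow> bool" where
  "dual_left_ideal s \<Delta> L \<longleftrightarrow>
     L \<subseteq> dual_elems s \<and> (\<lambda>_. 0) \<in> L \<and> (\<forall>f\<in>L. \<forall>g\<in>L. (\<lambda>x. f x + g x) \<in> L) \<and>
     (\<forall>c. \<forall>f\<in>L. (\<lambda>x. c * f x) \<in> L) \<and> (\<forall>g\<in>dual_elems s. \<forall>f\<in>L. conv \<Delta> g f \<in> L)"

definition dual_semisimple :: "('k::field \<Rightarrow> 'K::ring_1 \<Rightarrow> 'K) \<Rightarrow> ('K \<Rightarrow> ('K \<times> 'K) list) \<Rightarrow> bool" where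
  "dual_semisimple s \<Delta> \<longleftrightarrow>
     (\<forall>L. dual_left_ideal s \<Delta> L \<longrightarrow>
        (\<exists>L'. dual_left_ideal s \<Delta> L' \<and> L \<inter> L' = {\<lambda>_. 0} \<and>
              (\<forall>f\<in>dual_elems s. \<exists>a\<in>L. \<exists>b\<in>L'. f = (\<lambda>x. a x + b x))))"

end

theory Submission
  imports Defs "HOL-Library.Function_Algebras"
begin

text \<open>
  Triviality of the homological codeterminant makes the Frobenius functional \<open>B e 1\<close> colinear. Write
  \<open>a\<^sub>1 \<otimes> a\<^sub>0\<close> for the coaction on \<open>a\<close>; then \<open>a\<^sub>1 b\<^sub>1 B(a\<^sub>0, b\<^sub>0) = B(a, b) 1\<close> in \<open>K\<close>. Multiplying by the antipode gives
  \<open>S(a\<^sub>1) B(a\<^sub>0, b) = b\<^sub>1 B(a, b\<^sub>0)\<close>. For \<open>a\<close> of degree one, \<open>B(a, b)\<close> and \<open>B(b, a)\<close> differ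
  by a constant factor, so applying this identity twice shows that \<open>S\<^sup>2\<close> fixes all matrix coefficients
  of the first graded piece. These coefficients and their antipodes generate a Hopf subalgebra, which
  is \<open>K\<close> by inner-faithfulness.

  If \<open>K\<close> is finite dimensional and \<open>S\<^sup>2 = id\<close>, the regular character \<open>\<chi>(x) = Tr(y \<mapsto> x y)\<close> is an
  integral in the dual of \<open>K\<close>, and \<open>\<chi>(1) = dim K\<close>. If this is nonzero, averaging a linear projection
  over \<open>\<chi>\<close> as in Maschke's theorem splits every left ideal of the dual.
\<close>

section \<open>Tensors as lists of pairs\<close>

lemma lin_fun_iff_lin_map: "lin_fun s f \<longleftrightarrow> lin_map s (*) f"
  by (simp add: lin_fun_def lin_map_def)

lemma vector_space_field: "vector_space ((*) :: 'k::field \<Rightarrow> 'k \<Rightarrow> 'k)"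
  by unfold_locales (auto simp: algebra_simps)

lemma lin_map_add: "lin_map s t f \<Longrightarrow> f (x + y) = f x + f y"
  and lin_map_scale: "lin_map s t f \<Longrightarrow> f (s c x) = t c (f x)"
  by (auto simp: lin_map_def)

lemma lin_map_0: "lin_map s t f \<Longrightarrow> f 0 = 0"
  using lin_map_add[of s t f 0 0] by simp

lemma lin_map_sum: "lin_map s t f \<Longrightarrow> f (\<Sum>i\<in>F. g i) = (\<Sum>i\<in>F. f (g i))"
  by (induction F rule: infinite_finite_induct) (auto simp: lin_map_0 lin_map_add)

lemma lin_map_compose: "lin_map s t f \<Longrightarrow> lin_map r s g \<Longrightarrow> lin_map r t (\<lambda>x. f (g x))"
  by (simp add: lin_map_def)

lemma lin_map_id: "lin_map s s (\<lambda>x. x)"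
  by (simp add: lin_map_def)

lemma lin_map_scale_const:
  "vector_space t \<Longrightarrow> lin_map r t f \<Longrightarrow> lin_map r t (\<lambda>x. t c (f x))"
  by (auto simp: lin_map_def module.scale_right_distrib module.scale_scale mult.commute
      module_iff_vector_space)

lemma lin_map_scale_vec:
  "vector_space t \<Longrightarrow> lin_map r (*) f \<Longrightarrow> lin_map r t (\<lambda>x. t (f x) v)"
  by (auto simp: lin_map_def module.scale_left_distrib module.scale_scale module_iff_vector_space)

lemma lin_map_field_mult:
  "lin_map r (*) f \<Longrightarrow> lin_map r (*) (\<lambda>x. f x * (c::'k::field))"
  "lin_map r (*) f \<Longrightarrow> lin_map r (*) (\<lambda>x. c * f x)"
  by (auto simp: lin_map_def algebra_simps)

lemma lin_map_plus:
  "vector_space t \<Longrightarrow> lin_map r t f \<Longrightarrow> lin_map r t g \<Longrightarrow> lin_map r t (\<lambda>x. f x + g x)"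
  by (auto simp: lin_map_def module.scale_right_distrib module_iff_vector_space)

lemma lin_map_sum_fun:
  assumes "vector_space t" "\<And>i. i \<in> F \<Longrightarrow> lin_map r t (f i)"
  shows "lin_map r t (\<lambda>x. \<Sum>i\<in>F. f i x)"
proof -
  interpret vector_space t by fact
  show ?thesis
    using assms(2) by (auto simp: lin_map_def sum.distrib scale_sum_right)
qed

section \<open>Bilinear maps and their values on tensors\<close>

definition bilin :: "('k::field \<Rightarrow> 'a::ab_group_add \<Rightarrow> 'a) \<Rightarrow> ('k \<Rightarrow> 'b::ab_group_add \<Rightarrow> 'b)
    \<Rightarrow> ('k \<Rightarrow> 'w::ab_group_add \<Rightarrow> 'w) \<Rightarrow> ('a \<Rightarrow> 'b \<Rightarrow> 'w) \<Rightarrow> bool" where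
  "bilin sA sB t \<phi> \<longleftrightarrow> (\<forall>b. lin_map sA t (\<lambda>a. \<phi> a b)) \<and> (\<forall>a. lin_map sB t (\<lambda>b. \<phi> a b))"

lemma bilinI:
  "(\<And>b. lin_map sA t (\<lambda>a. \<phi> a b)) \<Longrightarrow> (\<And>a. lin_map sB t (\<lambda>b. \<phi> a b)) \<Longrightarrow> bilin sA sB t \<phi>"
  by (simp add: bilin_def)

lemma bilin_left: "bilin sA sB t \<phi> \<Longrightarrow> lin_map r sA f \<Longrightarrow> lin_map r t (\<lambda>x. \<phi> (f x) b)"
  by (auto simp: bilin_def lin_map_def)

lemma bilin_right: "bilin sA sB t \<phi> \<Longrightarrow> lin_map r sB f \<Longrightarrow> lin_map r t (\<lambda>x. \<phi> a (f x))"
  by (auto simp: bilin_def lin_map_def)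

text \<open>In Sweedler notation, \<^term>\<open>tapp (\<Delta> x) \<phi>\<close> is the sum of the values
  of \<open>\<phi>\<close> at \<open>(x\<^sub>1, x\<^sub>2)\<close>; nesting \<open>tapp\<close> gives the iterated coproducts.\<close>

definition tapp :: "('a \<times> 'b) list \<Rightarrow> ('a \<Rightarrow> 'b \<Rightarrow> 'w::comm_monoid_add) \<Rightarrow> 'w" where
  "tapp xs \<phi> = (\<Sum>(a, b)\<leftarrow>xs. \<phi> a b)"

lemma tapp_simps [simp]:
  "tapp [] \<phi> = 0"
  "tapp ((a, b) # xs) \<phi> = \<phi> a b + tapp xs \<phi>"
  "tapp (xs @ ys) \<phi> = tapp xs \<phi> + tapp ys \<phi>"
  by (simp_all add: tapp_def)

lemma teval_eq_tapp: "teval xs f g = tapp xs (\<lambda>a b. f a * g b)"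
  by (simp add: teval_def tapp_def)

lemma tapp_map: "tapp (map (\<lambda>(a, b). (f a b, g a b)) xs) \<phi> = tapp xs (\<lambda>a b. \<phi> (f a b) (g a b))"
  by (induction xs) auto

lemma tapp_map_list: "tapp (map (\<lambda>v. (f v, g v)) vs) \<phi> = (\<Sum>v\<leftarrow>vs. \<phi> (f v) (g v))"
  by (induction vs) auto

lemma tapp_product:
  "tapp [(f a c, g b d). (a, b) \<leftarrow> xs, (c, d) \<leftarrow> ys] \<phi>
     = tapp xs (\<lambda>a b. tapp ys (\<lambda>c d. \<phi> (f a c) (g b d)))"
proof (induction xs)
  case (Cons p xs)
  have "tapp (map (\<lambda>(c, d). (f a c, g b d)) ys) \<phi> = tapp ys (\<lambda>c d. \<phi> (f a c) (g b d))" for a b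
    by (rule tapp_map)
  with Cons show ?case by (cases p) auto
qed simp

lemma tapp_cong: "(\<And>a b. (a, b) \<in> set xs \<Longrightarrow> \<phi> a b = \<psi> a b) \<Longrightarrow> tapp xs \<phi> = tapp xs \<psi>"
  by (induction xs) auto

lemma tapp_add: "tapp xs (\<lambda>a b. \<phi> a b + \<psi> a b) = tapp xs \<phi> + tapp xs \<psi>"
  by (induction xs) (auto simp: algebra_simps)

lemma tapp_zero: "tapp xs (\<lambda>a b. 0) = 0"
  by (induction xs) auto

lemma tapp_sum: "tapp xs (\<lambda>a b. \<Sum>i\<in>F. \<phi> i a b) = (\<Sum>i\<in>F. tapp xs (\<phi> i))"
  by (induction xs) (auto simp: sum.distrib)

lemma tapp_swap:
  "tapp xs (\<lambda>a b. tapp ys (\<lambda>c d. \<phi> a b c d)) = tapp ys (\<lambda>c d. tapp xs (\<lambda>a b. \<phi> a b c d))"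
  by (induction xs) (auto simp: tapp_zero tapp_add)

lemma lin_map_tapp: "lin_map s t f \<Longrightarrow> f (tapp xs \<phi>) = tapp xs (\<lambda>a b. f (\<phi> a b))"
  by (induction xs) (auto simp: lin_map_add lin_map_0)

lemma lin_map_tapp_fun:
  assumes "vector_space t" "\<And>a b. lin_map r t (\<lambda>x. \<phi> x a b)"
  shows "lin_map r t (\<lambda>x. tapp xs (\<lambda>a b. \<phi> x a b))"
proof (induction xs)
  case Nil
  then show ?case using assms(1)
    by (auto simp: lin_map_def module.scale_zero_right module_iff_vector_space)
next
  case (Cons p xs)
  then show ?case using assms
    by (cases p) (auto intro!: lin_map_plus)
qed

section \<open>Coordinates, separating functionals and projections\<close>

context vector_space
begin

lemma lin_map_representation:
  assumes "independent Bs" "span Bs = UNIV"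
  shows "lin_map scale (*) (\<lambda>x. representation Bs x i)"
  using assms by (simp add: lin_map_def representation_add representation_scale)

text \<open>The space may be infinite dimensional, but a list of tensors involves only finitely many
  vectors, so only the basis vectors occurring in \<open>A\<close> are kept. The coordinates
  \<open>h i\<close> stay linear on the whole space, which makes them admissible test functionals
  for \<open>teq\<close>.\<close>

lemma finite_coordinates:
  assumes "finite A"
  obtains F h where "finite F" "\<And>i. lin_map scale (*) (h i)"
    "\<And>x. x \<in> A \<Longrightarrow> x = (\<Sum>i\<in>F. scale (h i x) i)"
proof -
  define Bs where "Bs = extend_basis {}"
  have Bs: "independent Bs" "span Bs = UNIV"
    by (auto simp: Bs_def independent_extend_basis independent_empty)
  define F where "F = (\<Union>x\<in>A. {i. representation Bs x i \<noteq> 0})"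
  have fin: "finite F"
    using assms by (auto simp: F_def finite_representation)
  have "x = (\<Sum>i\<in>F. scale (representation Bs x i) i)" if "x \<in> A" for x
  proof -
    have "x = (\<Sum>i | representation Bs x i \<noteq> 0. scale (representation Bs x i) i)"
      using sum_nonzero_representation_eq[of Bs x] Bs by simp
    also have "\<dots> = (\<Sum>i\<in>F. scale (representation Bs x i) i)"
      using that fin by (intro sum.mono_neutral_left) (auto simp: F_def)
    finally show ?thesis .
  qed
  with fin lin_map_representation[OF Bs] show ?thesis
    by (intro that[of F "\<lambda>i x. representation Bs x i"])
qed

lemma functionals_separate:
  assumes "\<And>f. lin_map scale (*) f \<Longrightarrow> f x = f y"
  shows "x = y"
proof -
  obtain F h where h: "finite F" "\<And>i. lin_map scale (*) (h i)"
    "\<And>z. z \<in> {x, y} \<Longrightarrow> z = (\<Sum>i\<in>F. scale (h i z) i)"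
    by (rule finite_coordinates[of "{x, y}"]) auto
  have "h i x = h i y" for i
    using assms h(2) .
  then show ?thesis
    using h(3)[of x] h(3)[of y] by simp
qed

end

lemma (in vector_space) lin_map_eq_on_span:
  assumes "lin_map scale t f" "lin_map scale t g" "\<And>x. x \<in> Bs \<Longrightarrow> f x = g x" "span Bs = UNIV"
  shows "f x = g x"
proof -
  have "subspace {x. f x = g x}"
    using assms(1,2) by (auto simp: subspace_def lin_map_add lin_map_scale lin_map_0)
  then have "span Bs \<subseteq> {x. f x = g x}"
    using assms(3) by (intro span_minimal) auto
  then show ?thesis using assms(4) by auto
qed

lemma (in vector_space) subspace_projection:
  assumes "subspace V"
  obtains p where "lin_map scale scale p" "\<And>x. p x \<in> V" "\<And>x. x \<in> V \<Longrightarrow> p x = x"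
proof -
  interpret vector_space_pair scale scale by unfold_locales
  obtain p where "p ` UNIV \<subseteq> V" "Vector_Spaces.linear scale scale p" "\<forall>v\<in>V. p (id v) = v"
    using linear_exists_left_inverse_on[OF linear_id assms] by auto
  then show ?thesis
    by (intro that[of p]) (auto simp: Vector_Spaces.linear_iff lin_map_def)
qed

section \<open>Multilinear maps on equal tensors\<close>

text \<open>\<open>teq\<close> tests only products of functionals. A functional \<open>g\<close> on
  the target and coordinates on the second factor write \<open>g (\<phi> a b)\<close> as a finite
  sum of such products on the entries of both lists, and the functionals \<open>g\<close> separate
  points.\<close>

lemma teq_tapp:
  fixes t :: "'k::field \<Rightarrow> 'w::ab_group_add \<Rightarrow> 'w"
  assumes vs: "vector_space sB" "vector_space t"
    and eq: "teq sA sB xs ys" and \<phi>: "bilin sA sB t \<phi>"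
  shows "tapp xs \<phi> = tapp ys \<phi>"
proof (rule vector_space.functionals_separate[OF vs(2)])
  fix g :: "'w \<Rightarrow> 'k" assume g: "lin_map t (*) g"
  obtain F h where h: "finite F" "\<And>i. lin_map sB (*) (h i)"
    "\<And>b. b \<in> snd ` set (xs @ ys) \<Longrightarrow> b = (\<Sum>i\<in>F. sB (h i b) i)"
    by (rule vector_space.finite_coordinates[OF vs(1), of "snd ` set (xs @ ys)"]) auto
  have 1: "g (\<phi> a b) = (\<Sum>i\<in>F. g (\<phi> a i) * h i b)" if "b \<in> snd ` set (xs @ ys)" for a b
  proof -
    have l: "lin_map sB (*) (\<lambda>b. g (\<phi> a b))"
      using \<phi> g by (auto simp: bilin_def intro: lin_map_compose)
    have "g (\<phi> a b) = g (\<phi> a (\<Sum>i\<in>F. sB (h i b) i))"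
      using h(3)[OF that] by simp
    also have "\<dots> = (\<Sum>i\<in>F. g (\<phi> a i) * h i b)"
      by (simp add: lin_map_sum[OF l] lin_map_scale[OF l] mult.commute)
    finally show ?thesis .
  qed
  have 2: "tapp zs (\<lambda>a b. g (\<phi> a b)) = (\<Sum>i\<in>F. teval zs (\<lambda>a. g (\<phi> a i)) (h i))"
    if "set zs \<subseteq> set (xs @ ys)" for zs
  proof -
    have "tapp zs (\<lambda>a b. g (\<phi> a b)) = tapp zs (\<lambda>a b. \<Sum>i\<in>F. g (\<phi> a i) * h i b)"
      using that by (intro tapp_cong 1) force
    then show ?thesis by (simp add: tapp_sum teval_eq_tapp)
  qed
  have "teval xs (\<lambda>a. g (\<phi> a i)) (h i) = teval ys (\<lambda>a. g (\<phi> a i)) (h i)" for i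
    using eq \<phi> g h(2) by (auto simp: teq_def lin_fun_iff_lin_map bilin_def intro: lin_map_compose)
  then show "g (tapp xs \<phi>) = g (tapp ys \<phi>)"
    by (simp add: lin_map_tapp[OF g] 2)
qed

lemma teqI_tapp:
  assumes "\<And>\<phi>. bilin sA sB (*) \<phi> \<Longrightarrow> tapp xs \<phi> = tapp ys \<phi>"
  shows "teq sA sB xs ys"
  unfolding teq_def teval_eq_tapp lin_fun_iff_lin_map
  by (intro allI impI assms bilinI lin_map_field_mult)

lemma tapp_mult_left: "(c::'r::ring) * tapp xs \<phi> = tapp xs (\<lambda>a b. c * \<phi> a b)"
  by (induction xs) (auto simp: algebra_simps)

lemma tapp_mult_right: "tapp xs \<phi> * (c::'r::ring) = tapp xs (\<lambda>a b. \<phi> a b * c)"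
  by (induction xs) (auto simp: algebra_simps)

lemma (in vector_space) tapp_scale: "scale c (tapp xs \<phi>) = tapp xs (\<lambda>a b. scale c (\<phi> a b))"
  by (induction xs) (auto simp: scale_right_distrib)

text \<open>A list-valued map is linear only up to \<open>teq\<close>; applying a bilinear map
  removes this ambiguity. The lemma serves the coproduct and the coaction alike.\<close>

lemma lin_map_coaction:
  fixes t :: "'k::field \<Rightarrow> 'w::ab_group_add \<Rightarrow> 'w"
  assumes vs: "vector_space sV" "vector_space t"
    and \<rho>: "\<And>c x y. teq sK sV (\<rho> (sV c x + y)) (map (\<lambda>(a, e). (sK c a, e)) (\<rho> x) @ \<rho> y)"
    and \<phi>: "bilin sK sV t \<phi>"
  shows "lin_map sV t (\<lambda>x. tapp (\<rho> x) \<phi>)"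
proof -
  interpret V: vector_space sV by fact
  interpret t: vector_space t by fact
  have *: "tapp (\<rho> (sV c x + y)) \<phi> = t c (tapp (\<rho> x) \<phi>) + tapp (\<rho> y) \<phi>" for c x y
  proof -
    have "\<phi> (sK c a) e = t c (\<phi> a e)" for a e
      using \<phi> by (auto simp: bilin_def lin_map_def)
    then show ?thesis
      using teq_tapp[OF vs \<rho> \<phi>, of c x y] by (simp add: tapp_map t.tapp_scale)
  qed
  have "tapp (\<rho> 0) \<phi> = 0"
    using *[of 1 0 0] by simp
  then show ?thesis
    using *[of 1] *[of _ _ 0] by (simp add: lin_map_def)
qed

text \<open>The analogue of \<open>teq_tapp\<close> for triple tensors, which are encoded as nested
  pairs. Coordinates on the third factor reduce it to finitely many equalities of ordinary
  tensors.\<close>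

lemma tapp_trilinear:
  fixes t :: "'k::field \<Rightarrow> 'w::ab_group_add \<Rightarrow> 'w" and sA :: "'k \<Rightarrow> 'a::ab_group_add \<Rightarrow> 'a"
    and X Y :: "(('a \<times> 'b::ab_group_add) \<times> 'c::ab_group_add) list"
  assumes vs: "vector_space sA" "vector_space sB" "vector_space sC" "vector_space t"
    and eq: "\<And>f g h. lin_map sA (*) f \<Longrightarrow> lin_map sB (*) g \<Longrightarrow> lin_map sC (*) h
      \<Longrightarrow> tapp X (\<lambda>(a, b) c. f a * g b * h c) = tapp Y (\<lambda>(a, b) c. f a * g b * h c)"
    and \<phi>: "\<And>b c. lin_map sA t (\<lambda>a. \<phi> a b c)" "\<And>a c. lin_map sB t (\<lambda>b. \<phi> a b c)"
      "\<And>a b. lin_map sC t (\<lambda>c. \<phi> a b c)"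
  shows "tapp X (\<lambda>(a, b) c. \<phi> a b c) = tapp Y (\<lambda>(a, b) c. \<phi> a b c)"
proof -
  obtain F h where h: "finite F" "\<And>i. lin_map sC (*) (h i)"
    "\<And>b. b \<in> snd ` set (X @ Y) \<Longrightarrow> b = (\<Sum>i\<in>F. sC (h i b) i)"
    by (rule vector_space.finite_coordinates[OF vs(3), of "snd ` set (X @ Y)"]) auto
  have 1: "\<phi> a b c = (\<Sum>i\<in>F. t (h i c) (\<phi> a b i))" if "c \<in> snd ` set (X @ Y)" for a b c
  proof -
    have "\<phi> a b c = \<phi> a b (\<Sum>i\<in>F. sC (h i c) i)"
      using h(3)[OF that] by simp
    also have "\<dots> = (\<Sum>i\<in>F. t (h i c) (\<phi> a b i))"
      by (simp add: lin_map_sum[OF \<phi>(3)] lin_map_scale[OF \<phi>(3)])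
    finally show ?thesis .
  qed
  \<comment> \<open>\<open>W i Z\<close> contracts the third factor with the coordinate
    \<open>h i\<close> and absorbs the resulting scalar into the first factor.\<close>
  define W where "W i Z = map (\<lambda>((a, b), c). (sA (h i c) a, b)) Z" for i and Z :: "(('a \<times> 'b) \<times> 'c) list"
  have W: "tapp (W i Z) \<psi> = tapp Z (\<lambda>(a, b) c. \<psi> (sA (h i c) a) b)" for i Z and \<psi> :: "'a \<Rightarrow> 'b \<Rightarrow> 'z::comm_monoid_add"
    by (induction Z) (auto simp: W_def)
  have 2: "tapp Z (\<lambda>(a, b) c. \<phi> a b c) = (\<Sum>i\<in>F. tapp (W i Z) (\<lambda>a b. \<phi> a b i))"
    if "set Z \<subseteq> set (X @ Y)" for Z
  proof -
    have "tapp Z (\<lambda>(a, b) c. \<phi> a b c) = tapp Z (\<lambda>p c. \<Sum>i\<in>F. (case p of (a, b) \<Rightarrow> t (h i c) (\<phi> a b i)))"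
    proof (rule tapp_cong)
      fix p c assume "(p, c) \<in> set Z"
      then have "c \<in> snd ` set (X @ Y)" using that by force
      then show "(case p of (a, b) \<Rightarrow> \<phi> a b) c = (\<Sum>i\<in>F. (case p of (a, b) \<Rightarrow> t (h i c) (\<phi> a b i)))"
        by (cases p) (simp add: 1[of c])
    qed
    also have "\<dots> = (\<Sum>i\<in>F. tapp (W i Z) (\<lambda>a b. \<phi> a b i))"
      by (auto simp: tapp_sum W lin_map_scale[OF \<phi>(1)] intro!: sum.cong tapp_cong)
    finally show ?thesis .
  qed
  have "tapp (W i X) (\<lambda>a b. \<phi> a b i) = tapp (W i Y) (\<lambda>a b. \<phi> a b i)" for i
  proof (rule teq_tapp[OF vs(2,4)])
    show "bilin sA sB t (\<lambda>a b. \<phi> a b i)"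
      using \<phi> by (intro bilinI)
    show "teq sA sB (W i X) (W i Y)"
      unfolding teq_def lin_fun_iff_lin_map
    proof (intro allI impI)
      fix f g assume fg: "lin_map sA (*) f" "lin_map sB (*) g"
      have "(\<lambda>(a, b) c. f (sA (h i c) a) * g b) = (\<lambda>(a, b) c. f a * g b * h i c)"
        by (auto simp: lin_map_scale[OF fg(1)] fun_eq_iff)
      then show "teval (W i X) f g = teval (W i Y) f g"
        using eq[OF fg h(2)[of i]] by (simp add: teval_eq_tapp W)
    qed
  qed
  then show ?thesis by (simp add: 2)
qed

lemma tapp_nested_left:
  "tapp xs (\<lambda>a b. tapp (G a) (\<lambda>c d. \<phi> c d b))
     = tapp [((c, d), b). (a, b) \<leftarrow> xs, (c, d) \<leftarrow> G a] (\<lambda>(c, d) b. \<phi> c d b)"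
proof (induction xs)
  case (Cons p xs)
  have "tapp (map (\<lambda>p. (p, b)) ys) (\<lambda>(c, d) b. \<phi> c d b) = tapp ys (\<lambda>c d. \<phi> c d b)" for b ys
    by (induction ys) auto
  with Cons show ?case by (cases p) auto
qed simp

lemma tapp_nested_right:
  "tapp xs (\<lambda>a b. tapp (G b) (\<lambda>c d. \<phi> a c d))
     = tapp [((a, c), d). (a, b) \<leftarrow> xs, (c, d) \<leftarrow> G b] (\<lambda>(a, c) d. \<phi> a c d)"
proof (induction xs)
  case (Cons p xs)
  have "tapp (map (\<lambda>(c, d). ((a, c), d)) ys) (\<lambda>(a, c) d. \<phi> a c d) = tapp ys (\<lambda>c d. \<phi> a c d)" for a ys
    by (induction ys) auto
  with Cons show ?case by (cases p) auto
qed simp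

text \<open>Flattening both nestings to triple tensors reduces the claim to
  \<open>tapp_trilinear\<close>. Two maps \<open>G\<close> and \<open>G'\<close> are allowed because
  the coaction axiom has \<open>\<Delta>\<close> on one side and \<open>\<rho>\<close> on the
  other.\<close>

lemma tapp_coassoc:
  fixes t :: "'k::field \<Rightarrow> 'w::ab_group_add \<Rightarrow> 'w"
  assumes vs: "vector_space sA" "vector_space sB" "vector_space sC" "vector_space t"
    and eq: "\<And>f g h. lin_map sA (*) f \<Longrightarrow> lin_map sB (*) g \<Longrightarrow> lin_map sC (*) h
      \<Longrightarrow> tapp xs (\<lambda>a b. teval (G a) f g * h b) = tapp ys (\<lambda>a b. f a * teval (G' b) g h)"
    and \<phi>: "\<And>b c. lin_map sA t (\<lambda>a. \<phi> a b c)" "\<And>a c. lin_map sB t (\<lambda>b. \<phi> a b c)"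
      "\<And>a b. lin_map sC t (\<lambda>c. \<phi> a b c)"
  shows "tapp xs (\<lambda>a b. tapp (G a) (\<lambda>c d. \<phi> c d b)) = tapp ys (\<lambda>a b. tapp (G' b) (\<lambda>c d. \<phi> a c d))"
  unfolding tapp_nested_left tapp_nested_right
proof (rule tapp_trilinear[OF vs _ \<phi>])
  fix f g h assume fgh: "lin_map sA (*) f" "lin_map sB (*) g" "lin_map sC (*) h"
  have 1: "teval zs f g * h b = tapp zs (\<lambda>c d. f c * g d * h b)" for zs b
    by (induction zs) (auto simp: teval_def algebra_simps)
  have 2: "f a * teval zs g h = tapp zs (\<lambda>c d. f a * g c * h d)" for zs a
    by (induction zs) (auto simp: teval_def algebra_simps)
  show "tapp [((c, d), b). (a, b) \<leftarrow> xs, (c, d) \<leftarrow> G a] (\<lambda>(a, b) c. f a * g b * h c)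
      = tapp [((a, c), d). (a, b) \<leftarrow> ys, (c, d) \<leftarrow> G' b] (\<lambda>(a, b) c. f a * g b * h c)"
    using eq[OF fgh] unfolding 1 2 tapp_nested_left tapp_nested_right .
qed

section \<open>Hopf algebras\<close>

locale hopf =
  fixes s :: "'k::field \<Rightarrow> 'K::ring_1 \<Rightarrow> 'K"
    and \<Delta> :: "'K \<Rightarrow> ('K \<times> 'K) list" and \<epsilon> :: "'K \<Rightarrow> 'k" and S :: "'K \<Rightarrow> 'K"
  assumes hopf: "hopf_algebra s \<Delta> \<epsilon> S"
begin

lemma vs: "vector_space s"
  and scale_mult: "s c x * y = s c (x * y)" "x * s c y = s c (x * y)"
  using hopf unfolding hopf_algebra_def k_algebra_def by metis+

sublocale vector_space s
  by (rule vs)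

lemma lin_map_mult:
  "lin_map r s f \<Longrightarrow> lin_map r s (\<lambda>x. f x * c)"
  "lin_map r s f \<Longrightarrow> lin_map r s (\<lambda>x. c * f x)"
  by (auto simp: lin_map_def algebra_simps scale_mult)

lemma lin_S: "lin_map s s S"
  and lin_\<epsilon>: "lin_map s (*) \<epsilon>"
  using hopf by (auto simp: hopf_algebra_def lin_fun_iff_lin_map)

lemma lin_\<Delta>:
  assumes "vector_space t" "bilin s s t \<phi>" "lin_map r s f"
  shows "lin_map r t (\<lambda>x. tapp (\<Delta> (f x)) \<phi>)"
proof (rule lin_map_compose[OF lin_map_coaction assms(3)])
  show "teq s s (\<Delta> (s c x + y)) (map (\<lambda>(a, e). (s c a, e)) (\<Delta> x) @ \<Delta> y)" for c x y
    using hopf unfolding hopf_algebra_def by blast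
qed (use assms vs in auto)

text \<open>Structural introduction rules that settle the multilinearity side conditions of
  computations in Sweedler notation.\<close>

lemmas lin = bilinI lin_map_id lin_map_compose[OF lin_S] lin_map_compose[OF lin_\<epsilon>] lin_map_mult
  lin_map_scale_const[OF vs] lin_map_scale_vec[OF vs] lin_map_field_mult lin_map_tapp_fun
  lin_\<Delta> vs vector_space_field

lemma \<Delta>_mult:
  assumes "vector_space t" "bilin s s t \<phi>"
  shows "tapp (\<Delta> (x * y)) \<phi> = tapp (\<Delta> x) (\<lambda>a b. tapp (\<Delta> y) (\<lambda>c d. \<phi> (a * c) (b * d)))"
proof -
  have "teq s s (\<Delta> (x * y)) [(a * c, b * d). (a, b) \<leftarrow> \<Delta> x, (c, d) \<leftarrow> \<Delta> y]"
    using hopf unfolding hopf_algebra_def by blast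
  from teq_tapp[OF vs assms(1) this assms(2)] show ?thesis
    by (simp only: tapp_product)
qed

lemma \<Delta>_one:
  assumes "vector_space t" "bilin s s t \<phi>"
  shows "tapp (\<Delta> 1) \<phi> = \<phi> 1 1"
proof -
  have "teq s s (\<Delta> 1) [(1, 1)]"
    using hopf unfolding hopf_algebra_def by blast
  from teq_tapp[OF vs assms(1) this assms(2)] show ?thesis
    by simp
qed

lemma \<Delta>_coassoc:
  assumes "vector_space t"
    "\<And>b c. lin_map s t (\<lambda>a. \<phi> a b c)" "\<And>a c. lin_map s t (\<lambda>b. \<phi> a b c)"
    "\<And>a b. lin_map s t (\<lambda>c. \<phi> a b c)"
  shows "tapp (\<Delta> x) (\<lambda>a b. tapp (\<Delta> a) (\<lambda>c d. \<phi> c d b))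
       = tapp (\<Delta> x) (\<lambda>a b. tapp (\<Delta> b) (\<lambda>c d. \<phi> a c d))"
proof (rule tapp_coassoc[OF vs vs vs assms(1) _ assms(2-4)])
  fix f g h assume "lin_map s (*) f" "lin_map s (*) g" "lin_map s (*) h"
  then show "tapp (\<Delta> x) (\<lambda>a b. teval (\<Delta> a) f g * h b) = tapp (\<Delta> x) (\<lambda>a b. f a * teval (\<Delta> b) g h)"
    using hopf unfolding hopf_algebra_def tapp_def lin_fun_iff_lin_map by blast
qed

lemma \<epsilon>_mult: "\<epsilon> (x * y) = \<epsilon> x * \<epsilon> y" and \<epsilon>_one: "\<epsilon> 1 = 1"
  using hopf by (auto simp: hopf_algebra_def)

lemma S_left: "tapp (\<Delta> x) (\<lambda>a b. S a * b) = s (\<epsilon> x) 1"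
  and S_right: "tapp (\<Delta> x) (\<lambda>a b. a * S b) = s (\<epsilon> x) 1"
  using hopf by (auto simp: hopf_algebra_def tapp_def)

lemma counit_right:
  assumes "lin_map s t f"
  shows "tapp (\<Delta> x) (\<lambda>a b. t (\<epsilon> b) (f a)) = f x"
proof -
  have "tapp (\<Delta> x) (\<lambda>a b. s (\<epsilon> b) a) = x"
    using hopf by (auto simp: hopf_algebra_def tapp_def)
  then have "f x = f (tapp (\<Delta> x) (\<lambda>a b. s (\<epsilon> b) a))" by simp
  then show ?thesis
    by (simp only: lin_map_tapp[OF assms] lin_map_scale[OF assms])
qed

lemma counit_left:
  assumes "lin_map s t f"
  shows "tapp (\<Delta> x) (\<lambda>a b. t (\<epsilon> a) (f b)) = f x"
proof -
  have "tapp (\<Delta> x) (\<lambda>a b. s (\<epsilon> a) b) = x"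
    using hopf by (auto simp: hopf_algebra_def tapp_def)
  then have "f x = f (tapp (\<Delta> x) (\<lambda>a b. s (\<epsilon> a) b))" by simp
  then show ?thesis
    by (simp only: lin_map_tapp[OF assms] lin_map_scale[OF assms])
qed

section \<open>The antipode reverses products and coproducts\<close>

lemma S_one: "S 1 = 1"
proof -
  have "tapp (\<Delta> 1) (\<lambda>a b. S a * b) = S 1 * 1"
    by (rule \<Delta>_one[OF vs]) (intro lin)+
  then show ?thesis by (simp add: S_left \<epsilon>_one)
qed

text \<open>The expression \<open>Q\<close>, which is \<open>S(x1 y1) x2 y2 S(y3) S(x3)\<close>, is
  evaluated in two ways. Collapsing \<open>y2 S(y3)\<close> and then \<open>x2 S(x3)\<close> leaves
  the left side; collapsing \<open>S(x1 y1) x2 y2\<close> leaves the right side.\<close>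

lemma S_mult: "S (x * y) = S y * S x"
proof -
  define Q where "Q = tapp (\<Delta> x) (\<lambda>a b. tapp (\<Delta> y) (\<lambda>c d. S (a * c) *
    tapp (\<Delta> b) (\<lambda>e f. tapp (\<Delta> d) (\<lambda>g h. e * g * S h * S f))))"
  have "tapp (\<Delta> d) (\<lambda>g h. e * g * S h * S f) = s (\<epsilon> d) (e * S f)" for d e f
  proof -
    have "tapp (\<Delta> d) (\<lambda>g h. e * g * S h * S f) = e * tapp (\<Delta> d) (\<lambda>g h. g * S h) * S f"
      by (simp add: tapp_mult_left tapp_mult_right mult.assoc)
    then show ?thesis by (simp add: S_right scale_mult)
  qed
  then have "Q = tapp (\<Delta> x) (\<lambda>a b. s (\<epsilon> b) (tapp (\<Delta> y) (\<lambda>c d. s (\<epsilon> d) (S (a * c)))))"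
    unfolding Q_def
    by (simp add: tapp_scale[symmetric] S_right scale_mult(2))
       (simp add: tapp_scale mult.commute)
  also have "(\<lambda>a. tapp (\<Delta> y) (\<lambda>c d. s (\<epsilon> d) (S (a * c)))) = (\<lambda>a. S (a * y))"
    by (intro ext counit_right lin)
  also have "tapp (\<Delta> x) (\<lambda>a b. s (\<epsilon> b) (S (a * y))) = S (x * y)"
    by (intro counit_right lin)
  finally have 1: "Q = S (x * y)" .
  have "Q = tapp (\<Delta> x) (\<lambda>a b. tapp (\<Delta> b) (\<lambda>e f. tapp (\<Delta> y) (\<lambda>c d. tapp (\<Delta> d) (\<lambda>g h.
      S (a * c) * (e * g * (S h * S f))))))"
    unfolding Q_def
    by (subst (3) tapp_swap) (simp add: tapp_mult_left mult.assoc)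
  also have "\<dots> = tapp (\<Delta> x) (\<lambda>u f. tapp (\<Delta> u) (\<lambda>a e. tapp (\<Delta> y) (\<lambda>c d. tapp (\<Delta> d) (\<lambda>g h.
      S (a * c) * (e * g * (S h * S f))))))"
    by (rule \<Delta>_coassoc[OF vs, symmetric]) (intro lin)+
  also have "(\<lambda>a e f. tapp (\<Delta> y) (\<lambda>c d. tapp (\<Delta> d) (\<lambda>g h. S (a * c) * (e * g * (S h * S f)))))
     = (\<lambda>a e f. tapp (\<Delta> y) (\<lambda>v h. tapp (\<Delta> v) (\<lambda>c g. S (a * c) * (e * g * (S h * S f)))))"
    by (intro ext \<Delta>_coassoc[OF vs, symmetric] lin)
  also have "tapp (\<Delta> x) (\<lambda>u f. tapp (\<Delta> u) (\<lambda>a e. tapp (\<Delta> y) (\<lambda>v h. tapp (\<Delta> v) (\<lambda>c g.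
      S (a * c) * (e * g * (S h * S f))))))
    = tapp (\<Delta> x) (\<lambda>u f. tapp (\<Delta> y) (\<lambda>v h. tapp (\<Delta> u) (\<lambda>a e. tapp (\<Delta> v) (\<lambda>c g.
      S (a * c) * (e * g))) * (S h * S f)))"
    by (simp add: tapp_mult_right mult.assoc tapp_swap[where xs = "\<Delta> u" and ys = "\<Delta> y" for u])
  \<comment> \<open>This is the left antipode identity at \<open>u * v\<close>, unfolded by
    multiplicativity of the coproduct.\<close>
  also have "(\<lambda>u v. tapp (\<Delta> u) (\<lambda>a e. tapp (\<Delta> v) (\<lambda>c g. S (a * c) * (e * g))))
     = (\<lambda>u v. s (\<epsilon> u) (s (\<epsilon> v) 1))"
  proof (intro ext)
    fix u v
    have "tapp (\<Delta> (u * v)) (\<lambda>p q. S p * q) = tapp (\<Delta> u) (\<lambda>a e. tapp (\<Delta> v) (\<lambda>c g. S (a * c) * (e * g)))"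
      by (rule \<Delta>_mult[OF vs]) (intro lin)+
    then show "tapp (\<Delta> u) (\<lambda>a e. tapp (\<Delta> v) (\<lambda>c g. S (a * c) * (e * g))) = s (\<epsilon> u) (s (\<epsilon> v) 1)"
      by (simp add: S_left \<epsilon>_mult)
  qed
  also have "tapp (\<Delta> x) (\<lambda>u f. tapp (\<Delta> y) (\<lambda>v h. s (\<epsilon> u) (s (\<epsilon> v) 1) * (S h * S f)))
    = tapp (\<Delta> x) (\<lambda>u f. s (\<epsilon> u) (tapp (\<Delta> y) (\<lambda>v h. s (\<epsilon> v) (S h * S f))))"
    by (simp add: tapp_scale scale_mult(1))
  also have "(\<lambda>f. tapp (\<Delta> y) (\<lambda>v h. s (\<epsilon> v) (S h * S f))) = (\<lambda>f. S y * S f)"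
    by (intro ext counit_left lin)
  also have "tapp (\<Delta> x) (\<lambda>u f. s (\<epsilon> u) (S y * S f)) = S y * S x"
    by (intro counit_left lin)
  finally show ?thesis using 1 by simp
qed

text \<open>The argument of \<open>S_mult\<close>, carried out in the tensor square. With
  \<open>p \<otimes> q\<close> the coproduct of \<open>S(x1)\<close>, the tensor
  \<open>p x2 S(x5) \<otimes> q x3 S(x4)\<close> is evaluated under \<open>\<phi>\<close> in two
  ways. Collapsing \<open>x3 S(x4)\<close> and then \<open>x2 S(x5)\<close> leaves the coproduct of
  \<open>S x\<close>; merging \<open>p \<otimes> q\<close> with \<open>x2 \<otimes> x3\<close> into
  the coproduct of \<open>S(x1) x2\<close> leaves the flipped side.\<close>

lemma \<Delta>_S:
  assumes t: "vector_space t" and \<phi>: "bilin s s t \<phi>"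
  shows "tapp (\<Delta> (S x)) \<phi> = tapp (\<Delta> x) (\<lambda>a b. \<phi> (S b) (S a))"
proof -
  interpret t: vector_space t by fact
  note lin' = lin t bilin_left[OF \<phi>] bilin_right[OF \<phi>]
    lin_map_scale_const[OF t] lin_map_scale_vec[OF t]
  define \<Psi> where "\<Psi> p q e f g h = \<phi> (p * (e * S h)) (q * (f * S g))" for p q e f g h
  define W where "W p q b = tapp (\<Delta> b) (\<lambda>c d. tapp (\<Delta> c) (\<lambda>e f. tapp (\<Delta> d) (\<lambda>g h. \<Psi> p q e f g h)))"
    for p q b
  define X where "X = tapp (\<Delta> x) (\<lambda>a b. tapp (\<Delta> (S a)) (\<lambda>p q. W p q b))"
  have W: "W p q b = t (\<epsilon> b) (\<phi> p q)" for p q b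
  proof -
    have "tapp (\<Delta> c) (\<lambda>f d. tapp (\<Delta> d) (\<lambda>g h. \<Psi> p q e f g h)) = \<phi> (p * (e * S c)) q" for c e
    proof -
      have "tapp (\<Delta> c) (\<lambda>f d. tapp (\<Delta> d) (\<lambda>g h. \<Psi> p q e f g h))
          = tapp (\<Delta> c) (\<lambda>u h. tapp (\<Delta> u) (\<lambda>f g. \<Psi> p q e f g h))"
        unfolding \<Psi>_def by (rule \<Delta>_coassoc[OF t, symmetric]) (intro lin')+
      also have "\<dots> = tapp (\<Delta> c) (\<lambda>u h. t (\<epsilon> u) (\<phi> (p * (e * S h)) q))"
      proof -
        have "tapp (\<Delta> u) (\<lambda>f g. \<Psi> p q e f g h) = t (\<epsilon> u) (\<phi> (p * (e * S h)) q)" for u h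
        proof -
          have l: "lin_map s t (\<lambda>z. \<phi> (p * (e * S h)) (q * z))"
            by (intro lin')
          have "tapp (\<Delta> u) (\<lambda>f g. \<Psi> p q e f g h) = \<phi> (p * (e * S h)) (q * tapp (\<Delta> u) (\<lambda>f g. f * S g))"
            unfolding \<Psi>_def by (rule lin_map_tapp[OF l, symmetric])
          then show ?thesis
            using lin_map_scale[OF l, of _ 1] by (simp add: S_right)
        qed
        then show ?thesis by simp
      qed
      also have "\<dots> = \<phi> (p * (e * S c)) q"
        by (intro counit_left lin')
      finally show ?thesis .
    qed
    moreover have "W p q b = tapp (\<Delta> b) (\<lambda>e c. tapp (\<Delta> c) (\<lambda>f d. tapp (\<Delta> d) (\<lambda>g h. \<Psi> p q e f g h)))"
      unfolding \<Psi>_def W_def by (rule \<Delta>_coassoc[OF t]) (intro lin')+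
    ultimately have "W p q b = tapp (\<Delta> b) (\<lambda>e c. \<phi> (p * (e * S c)) q)"
      by simp
    moreover have l: "lin_map s t (\<lambda>z. \<phi> (p * z) q)"
      by (intro lin')
    ultimately show ?thesis
      using lin_map_tapp[OF l, of "\<Delta> b" "\<lambda>e c. e * S c"] lin_map_scale[OF l, of _ 1] by (simp add: S_right)
  qed
  have "X = tapp (\<Delta> x) (\<lambda>a b. t (\<epsilon> b) (tapp (\<Delta> (S a)) \<phi>))"
    by (simp add: X_def W t.tapp_scale)
  also have "\<dots> = tapp (\<Delta> (S x)) \<phi>"
    by (intro counit_right lin' \<phi>)
  finally have 1: "X = tapp (\<Delta> (S x)) \<phi>" .
  \<comment> \<open>\<open>\<Theta> d\<close> is right multiplication by
    \<open>S(d2) \<otimes> S(d1)\<close> followed by \<open>\<phi>\<close>: what remains once the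
    factors to its left have been merged into one coproduct.\<close>
  define \<Theta> where "\<Theta> d m n = tapp (\<Delta> d) (\<lambda>g h. \<phi> (m * S h) (n * S g))" for d m n
  have \<Theta>: "bilin s s t (\<Theta> d)" for d
    unfolding \<Theta>_def by (intro lin')
  have Z: "tapp (\<Delta> (S a)) (\<lambda>p q. tapp (\<Delta> c) (\<lambda>e f. tapp (\<Delta> d) (\<lambda>g h. \<Psi> p q e f g h)))
      = tapp (\<Delta> (S a * c)) (\<Theta> d)" for a c d
    by (simp add: \<Delta>_mult[OF t \<Theta>] \<Theta>_def \<Psi>_def mult.assoc)
  have "X = tapp (\<Delta> x) (\<lambda>a b. tapp (\<Delta> b) (\<lambda>c d. tapp (\<Delta> (S a * c)) (\<Theta> d)))"
    unfolding X_def W_def Z[symmetric] by (subst (2) tapp_swap) simp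
  also have "\<dots> = tapp (\<Delta> x) (\<lambda>u d. tapp (\<Delta> u) (\<lambda>a c. tapp (\<Delta> (S a * c)) (\<Theta> d)))"
    unfolding \<Theta>_def by (rule \<Delta>_coassoc[OF t, symmetric]) (intro lin')+
  also have "\<dots> = tapp (\<Delta> x) (\<lambda>u d. t (\<epsilon> u) (\<Theta> d 1 1))"
  proof -
    have "tapp (\<Delta> u) (\<lambda>a c. tapp (\<Delta> (S a * c)) (\<Theta> d)) = t (\<epsilon> u) (\<Theta> d 1 1)" for u d
    proof -
      have l: "lin_map s t (\<lambda>z. tapp (\<Delta> z) (\<Theta> d))"
        by (intro lin' \<Theta>)
      show ?thesis
        using lin_map_tapp[OF l, of "\<Delta> u" "\<lambda>a c. S a * c"] lin_map_scale[OF l, of _ 1]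
        by (simp add: S_left \<Delta>_one[OF t \<Theta>])
    qed
    then show ?thesis by simp
  qed
  also have "\<dots> = \<Theta> x 1 1"
    unfolding \<Theta>_def by (intro counit_left lin')
  also have "\<dots> = tapp (\<Delta> x) (\<lambda>a b. \<phi> (S b) (S a))"
    by (simp add: \<Theta>_def)
  finally show ?thesis using 1 by simp
qed

end

section \<open>Frobenius comodule algebras\<close>

locale frobenius_coaction = hopf s \<Delta> \<epsilon> S
  for s :: "'k::field \<Rightarrow> 'K::ring_1 \<Rightarrow> 'K"
    and \<Delta> :: "'K \<Rightarrow> ('K \<times> 'K) list" and \<epsilon> :: "'K \<Rightarrow> 'k" and S :: "'K \<Rightarrow> 'K" +
  fixes sE :: "'k \<Rightarrow> 'E::ring_1 \<Rightarrow> 'E" and gr :: "nat \<Rightarrow> 'E set"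
    and B :: "'E \<Rightarrow> 'E \<Rightarrow> 'k" and \<rho> :: "'E \<Rightarrow> ('K \<times> 'E) list"
  assumes graded: "connected_graded sE gr"
    and frobenius: "frobenius_form sE gr B"
    and comodule: "graded_comodule_algebra s \<Delta> \<epsilon> sE gr \<rho>"
    and codet: "codeterminant_trivial s sE gr \<rho>"
begin

lemma vsE: "vector_space sE"
  using graded by (auto simp: connected_graded_def k_algebra_def)

sublocale E: vector_space sE
  by (rule vsE)

lemma lin_B: "lin_map r sE f \<Longrightarrow> lin_map r (*) (\<lambda>x. B (f x) b)"
  "lin_map r sE f \<Longrightarrow> lin_map r (*) (\<lambda>x. B a (f x))"
  using frobenius
  by (auto simp: frobenius_form_def lin_fun_iff_lin_map intro: lin_map_compose[where g = f])

lemma B_assoc: "B (a * b) c = B a (b * c)"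
  using frobenius by (auto simp: frobenius_form_def)

lemma lin_\<rho>:
  assumes "vector_space t" "bilin s sE t \<phi>" "lin_map r sE f"
  shows "lin_map r t (\<lambda>x. tapp (\<rho> (f x)) \<phi>)"
proof (rule lin_map_compose[OF lin_map_coaction assms(3)])
  show "teq s sE (\<rho> (sE c x + y)) (map (\<lambda>(a, e). (s c a, e)) (\<rho> x) @ \<rho> y)" for c x y
    using comodule unfolding graded_comodule_algebra_def by blast
qed (use assms vsE in auto)

lemma lin_map_multE:
  "lin_map r sE f \<Longrightarrow> lin_map r sE (\<lambda>x. f x * c)"
  "lin_map r sE f \<Longrightarrow> lin_map r sE (\<lambda>x. c * f x)"
proof -
  have "sE d x * y = sE d (x * y)" "x * sE d y = sE d (x * y)" for d x y
    using graded unfolding connected_graded_def k_algebra_def by metis+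
  then show "lin_map r sE f \<Longrightarrow> lin_map r sE (\<lambda>x. f x * c)"
    "lin_map r sE f \<Longrightarrow> lin_map r sE (\<lambda>x. c * f x)"
    by (auto simp: lin_map_def algebra_simps)
qed

lemmas linE = lin lin_\<rho> lin_B lin_map_multE vsE

lemma \<rho>_coassoc:
  assumes "vector_space t"
    "\<And>b c. lin_map s t (\<lambda>a. \<phi> a b c)" "\<And>a c. lin_map s t (\<lambda>b. \<phi> a b c)"
    "\<And>a b. lin_map sE t (\<lambda>c. \<phi> a b c)"
  shows "tapp (\<rho> x) (\<lambda>a e. tapp (\<Delta> a) (\<lambda>b c. \<phi> b c e))
       = tapp (\<rho> x) (\<lambda>a e. tapp (\<rho> e) (\<lambda>b f. \<phi> a b f))"
proof (rule tapp_coassoc[OF vs vs vsE assms(1) _ assms(2-4)])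
  fix f g h assume "lin_map s (*) f" "lin_map s (*) g" "lin_map sE (*) h"
  then have "tapp (\<rho> x) (\<lambda>a b. f a * teval (\<rho> b) g h) = tapp (\<rho> x) (\<lambda>a b. teval (\<Delta> a) f g * h b)"
    using comodule unfolding graded_comodule_algebra_def tapp_def lin_fun_iff_lin_map by blast
  then show "tapp (\<rho> x) (\<lambda>a b. teval (\<Delta> a) f g * h b) = tapp (\<rho> x) (\<lambda>a b. f a * teval (\<rho> b) g h)"
    by simp
qed

lemma \<rho>_counit:
  assumes "lin_map sE t f"
  shows "tapp (\<rho> x) (\<lambda>a e. t (\<epsilon> a) (f e)) = f x"
proof -
  have "tapp (\<rho> x) (\<lambda>a e. sE (\<epsilon> a) e) = x"
    using comodule by (auto simp: graded_comodule_algebra_def tapp_def)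
  then have "f x = f (tapp (\<rho> x) (\<lambda>a e. sE (\<epsilon> a) e))" by simp
  then show ?thesis
    by (simp only: lin_map_tapp[OF assms] lin_map_scale[OF assms])
qed

lemma \<rho>_mult:
  assumes "vector_space t" "bilin s sE t \<phi>"
  shows "tapp (\<rho> (x * y)) \<phi> = tapp (\<rho> x) (\<lambda>a e. tapp (\<rho> y) (\<lambda>b f. \<phi> (a * b) (e * f)))"
proof -
  have "teq s sE (\<rho> (x * y)) [(a * b, e * e'). (a, e) \<leftarrow> \<rho> x, (b, e') \<leftarrow> \<rho> y]"
    using comodule unfolding graded_comodule_algebra_def by blast
  from teq_tapp[OF vsE assms(1) this assms(2)] show ?thesis
    by (simp only: tapp_product)
qed

text \<open>The list \<open>\<rho> x\<close> itself may have second entries outside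
  \<open>gr i\<close>. Only an equal tensor with entries in \<open>gr i\<close> is available, so
  both maps have to be bilinear to be transported to it.\<close>

lemma tapp_\<rho>_cong:
  assumes "x \<in> gr i" "vector_space t" "bilin s sE t \<phi>" "bilin s sE t \<psi>"
    and "\<And>k e. e \<in> gr i \<Longrightarrow> \<phi> k e = \<psi> k e"
  shows "tapp (\<rho> x) \<phi> = tapp (\<rho> x) \<psi>"
proof -
  have "tin s sE (\<rho> x) UNIV (gr i)"
    using comodule assms(1) unfolding graded_comodule_algebra_def by blast
  then obtain ys where ys: "set ys \<subseteq> UNIV \<times> gr i" "teq s sE (\<rho> x) ys"
    by (auto simp: tin_def)
  have "tapp ys \<phi> = tapp ys \<psi>"
    using ys(1) assms(5) by (intro tapp_cong) blast
  then show ?thesis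
    by (simp add: teq_tapp[OF vsE assms(2) ys(2) assms(3)] teq_tapp[OF vsE assms(2) ys(2) assms(4)])
qed

lemma graded_ext:
  assumes "lin_map sE t f" "lin_map sE t g" "\<And>i x. x \<in> gr i \<Longrightarrow> f x = g x"
  shows "f x = g x"
proof -
  obtain c where c: "\<And>i. c i \<in> gr i" "x = sum c {i. c i \<noteq> 0}"
    using graded unfolding connected_graded_def by metis
  have "f x = (\<Sum>i | c i \<noteq> 0. f (c i))" "g x = (\<Sum>i | c i \<noteq> 0. g (c i))"
    by (subst c(2), simp add: lin_map_sum[OF assms(1)] lin_map_sum[OF assms(2)])+
  then show ?thesis
    using assms(3)[OF c(1)] by simp
qed

lemma one_in_gr0: "1 \<in> gr 0"
proof -
  have "gr 0 = range (\<lambda>c. sE c 1)"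
    using graded by (simp add: connected_graded_def)
  then show ?thesis
    using rangeI[of "\<lambda>c. sE c 1" 1] by simp
qed

lemma gr_mult: "a \<in> gr i \<Longrightarrow> b \<in> gr j \<Longrightarrow> a * b \<in> gr (i + j)"
  using graded by (simp add: connected_graded_def)

text \<open>Some degree \<open>d'\<close> supports the form, and it has to be \<open>d\<close>. By
  nondegeneracy a nonzero \<open>e\<close> of top degree pairs nontrivially with a homogeneous
  \<open>b'\<close>; associativity with the unit gives \<open>e * b' \<noteq> 0\<close>, so
  \<open>b'\<close> has degree zero. This ties the form to the codeterminant, which only concerns
  the top degree.\<close>

lemma form_degree_eq_top_degree:
  assumes "top_degree gr d" "a \<in> gr i" "b \<in> gr j" "i + j \<noteq> d"
  shows "B a b = 0"
proof -
  obtain d' where d': "\<And>i j a b. a \<in> gr i \<Longrightarrow> b \<in> gr j \<Longrightarrow> i + j \<noteq> d' \<Longrightarrow> B a b = 0"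
    using frobenius unfolding frobenius_form_def by metis
  have "E.subspace (gr d)"
    using graded by (simp add: connected_graded_def)
  then obtain e where e: "e \<in> gr d" "e \<noteq> 0"
    using assms(1) E.subspace_0 unfolding top_degree_def by blast
  have "\<exists>j b. b \<in> gr j \<and> B e b \<noteq> 0"
  proof (rule ccontr)
    assume "\<not> ?thesis"
    then have "B e b = 0" for b
      using graded_ext[of "(*)" "B e" "\<lambda>_. 0" b] lin_B(2)[OF lin_map_id, of e]
      by (auto simp: lin_map_def)
    then show False
      using e(2) frobenius unfolding frobenius_form_def by blast
  qed
  then obtain j' b' where b': "b' \<in> gr j'" "B e b' \<noteq> 0" by blast
  have "B (e * b') 1 \<noteq> 0"
    using b' by (simp add: B_assoc)
  then have "e * b' \<noteq> 0"
    using lin_map_0[OF lin_B(1)[OF lin_map_id]] by auto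
  then have "\<not> d + j' > d"
    using gr_mult[OF e(1) b'(1)] assms(1) unfolding top_degree_def by blast
  then have "d' = d"
    using d'[OF e(1) b'(1)] b'(2) by auto
  then show ?thesis
    using d' assms by blast
qed

text \<open>It suffices to check homogeneous elements. In top degree the claim is triviality of the
  codeterminant; in any other degree both sides vanish, since the coaction preserves the
  degree.\<close>

lemma trace_colinear: "tapp (\<rho> x) (\<lambda>k e. s (B e 1) k) = s (B x 1) 1"
proof (rule graded_ext[where f = "\<lambda>x. tapp (\<rho> x) (\<lambda>k e. s (B e 1) k)" and g = "\<lambda>x. s (B x 1) 1" and t = s])
  obtain d where d: "top_degree gr d" "\<And>e. e \<in> gr d \<Longrightarrow> teq s sE (\<rho> e) [(1, e)]"
    using codet unfolding codeterminant_trivial_def hom_codeterminant_def by blast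
  fix i x assume x: "x \<in> gr i"
  show "tapp (\<rho> x) (\<lambda>k e. s (B e 1) k) = s (B x 1) 1"
  proof (cases "i = d")
    case True
    then show ?thesis
      using teq_tapp[OF vsE vs d(2)[of x], of "\<lambda>k e. s (B e 1) k"] x by (simp add: linE)
  next
    case False
    then have 0: "B e 1 = 0" if "e \<in> gr i" for e
      using form_degree_eq_top_degree[OF d(1) that one_in_gr0] by simp
    have "tapp (\<rho> x) (\<lambda>k e. s (B e 1) k) = tapp (\<rho> x) (\<lambda>k e. 0)"
      using x by (intro tapp_\<rho>_cong[where t = s] linE) (auto simp: 0 bilin_def lin_map_def)
    then show ?thesis using 0[OF x] by (simp add: tapp_zero)
  qed
qed (intro linE)+

lemma form_colinear:
  "tapp (\<rho> a) (\<lambda>k e. tapp (\<rho> b) (\<lambda>l f. s (B e f) (k * l))) = s (B a b) 1"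
proof -
  have "tapp (\<rho> (a * b)) (\<lambda>k e. s (B e 1) k)
      = tapp (\<rho> a) (\<lambda>k e. tapp (\<rho> b) (\<lambda>l f. s (B (e * f) 1) (k * l)))"
    by (rule \<rho>_mult[OF vs]) (intro linE)+
  then show ?thesis
    by (simp add: trace_colinear B_assoc)
qed

section \<open>Matrix coefficients and their antipodes\<close>

text \<open>The matrix coefficient of the coaction at \<open>a\<close> and the functional that
  \<open>b\<close> represents through the form.\<close>

definition coef :: "'E \<Rightarrow> 'E \<Rightarrow> 'K" where
  "coef a b = tapp (\<rho> a) (\<lambda>k e. s (B e b) k)"

text \<open>\<open>form_colinear\<close> replaces the unit in \<open>S k * s (B e b) 1\<close>,
  which creates a second coaction on \<open>e\<close>. Coassociativity turns the two coactions into
  a coproduct of \<open>k\<close>, where \<open>S(k1) k2\<close> collapses to the counit.\<close>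

lemma S_coef: "S (coef a b) = tapp (\<rho> b) (\<lambda>l f. s (B a f) l)"
proof -
  have "S (coef a b) = tapp (\<rho> a) (\<lambda>k e. S k * s (B e b) 1)"
    by (simp add: coef_def lin_map_tapp[OF lin_S] lin_map_scale[OF lin_S] scale_mult)
  also have "\<dots> = tapp (\<rho> a) (\<lambda>k e. tapp (\<rho> e) (\<lambda>l e'. S k * tapp (\<rho> b) (\<lambda>m f. s (B e' f) (l * m))))"
    by (simp add: tapp_mult_left flip: form_colinear)
  also have "\<dots> = tapp (\<rho> a) (\<lambda>k e. tapp (\<Delta> k) (\<lambda>k1 k2. S k1 * tapp (\<rho> b) (\<lambda>m f. s (B e f) (k2 * m))))"
    by (rule \<rho>_coassoc[OF vs, symmetric]) (intro linE)+
  also have "\<dots> = tapp (\<rho> a) (\<lambda>k e. s (\<epsilon> k) (tapp (\<rho> b) (\<lambda>m f. s (B e f) m)))"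
  proof -
    have "tapp (\<Delta> k) (\<lambda>k1 k2. S k1 * tapp (\<rho> b) (\<lambda>m f. s (B e f) (k2 * m)))
        = s (\<epsilon> k) (tapp (\<rho> b) (\<lambda>m f. s (B e f) m))" for k e
    proof -
      have "tapp (\<Delta> k) (\<lambda>k1 k2. S k1 * tapp (\<rho> b) (\<lambda>m f. s (B e f) (k2 * m)))
        = tapp (\<Delta> k) (\<lambda>k1 k2. S k1 * k2) * tapp (\<rho> b) (\<lambda>m f. s (B e f) m)"
        unfolding tapp_mult_right by (simp add: tapp_mult_left scale_mult mult.assoc)
      then show ?thesis by (simp add: S_left scale_mult)
    qed
    then show ?thesis by simp
  qed
  also have "\<dots> = tapp (\<rho> b) (\<lambda>m f. s (B a f) m)"
    by (intro \<rho>_counit linE)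
  finally show ?thesis .
qed

text \<open>The formula for \<open>S (coef b a)\<close> is the one for \<open>S (coef a b)\<close> with the arguments of the form
  swapped; on degree one the Nakayama automorphism makes the swap a scalar, so \<open>S\<close> undoes itself.\<close>

lemma S_S_coef:
  assumes "nakayama B \<mu>" "\<forall>a\<in>gr 1. \<mu> a = sE c a" "a \<in> gr 1"
  shows "S (S (coef a b)) = coef a b"
proof -
  \<comment> \<open>The scalar \<open>c\<close> by which the Nakayama automorphism acts on
    \<open>gr 1\<close> measures the asymmetry of the form there.\<close>
  have sym: "B e f = c * B f e" if "e \<in> gr 1" for e f
    using assms(1,2) that lin_map_scale[OF lin_B(2)[OF lin_map_id], of f c e]
    unfolding nakayama_def by metis
  have "S (S (coef a b)) = tapp (\<rho> b) (\<lambda>l f. s (B a f) (S l))"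
    by (simp add: S_coef lin_map_tapp[OF lin_S] lin_map_scale[OF lin_S])
  also have "\<dots> = s c (S (coef b a))"
    by (simp add: coef_def sym[OF assms(3)] lin_map_tapp[OF lin_S] lin_map_scale[OF lin_S] tapp_scale)
  also have "\<dots> = tapp (\<rho> a) (\<lambda>k e. s (c * B b e) k)"
    by (simp add: S_coef tapp_scale)
  \<comment> \<open>Since \<open>a\<close> has degree one, the second tensor factors
    \<open>e\<close> may be taken in \<open>gr 1\<close>, where \<open>sym\<close> reabsorbs
    \<open>c\<close>.\<close>
  also have "\<dots> = coef a b"
    unfolding coef_def
    by (rule tapp_\<rho>_cong[OF assms(3) vs]) (use sym in \<open>auto intro!: linE\<close>)
  finally show ?thesis .
qed

end

section \<open>Hopf subalgebras from generators\<close>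

inductive_set alg_gen :: "('k::field \<Rightarrow> 'a::ring_1 \<Rightarrow> 'a) \<Rightarrow> 'a set \<Rightarrow> 'a set"
  for s :: "'k::field \<Rightarrow> 'a::ring_1 \<Rightarrow> 'a" and G :: "'a set" where
  base: "x \<in> G \<Longrightarrow> x \<in> alg_gen s G"
| one: "1 \<in> alg_gen s G"
| add: "x \<in> alg_gen s G \<Longrightarrow> y \<in> alg_gen s G \<Longrightarrow> x + y \<in> alg_gen s G"
| scale: "x \<in> alg_gen s G \<Longrightarrow> s c x \<in> alg_gen s G"
| mult: "x \<in> alg_gen s G \<Longrightarrow> y \<in> alg_gen s G \<Longrightarrow> x * y \<in> alg_gen s G"

text \<open>Closure passes from generators to the algebra because \<open>S\<close> reverses products
  and the coproduct is an algebra map up to \<open>teq\<close>.\<close>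

lemma (in hopf) alg_gen_hopf_subalgebra:
  assumes S: "\<And>x. x \<in> G \<Longrightarrow> S x \<in> G"
    and \<Delta>: "\<And>x. x \<in> G \<Longrightarrow> tin s s (\<Delta> x) G G"
  shows "hopf_subalgebra s \<Delta> S (alg_gen s G)"
  unfolding hopf_subalgebra_def
proof (intro conjI ballI image_subsetI)
  let ?A = "alg_gen s G"
  have "0 \<in> ?A"
    using alg_gen.scale[OF alg_gen.one, of s 0] by simp
  then show "module.subspace s ?A"
    by (auto simp: subspace_def intro: alg_gen.intros)
  show "1 \<in> ?A" by (rule alg_gen.one)
  show "x * y \<in> ?A" if "x \<in> ?A" "y \<in> ?A" for x y
    using that by (rule alg_gen.mult)
  show "S x \<in> ?A" if "x \<in> ?A" for x
    using that
  proof induction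
    case (base x)
    then show ?case by (intro alg_gen.base S)
  next
    case one
    then show ?case by (simp add: S_one alg_gen.one)
  next
    case (add x y)
    then show ?case by (simp add: lin_map_add[OF lin_S] alg_gen.add)
  next
    case (scale x c)
    then show ?case by (simp add: lin_map_scale[OF lin_S] alg_gen.scale)
  next
    case (mult x y)
    then show ?case by (simp add: S_mult alg_gen.mult)
  qed
  show "tin s s (\<Delta> x) ?A ?A" if "x \<in> ?A" for x
    using that
  proof induction
    case (base x)
    then obtain ys where ys: "set ys \<subseteq> G \<times> G" "teq s s (\<Delta> x) ys"
      using \<Delta> unfolding tin_def by metis
    moreover have "G \<times> G \<subseteq> ?A \<times> ?A"
      by (intro Sigma_mono subsetI alg_gen.base)
    ultimately show ?case unfolding tin_def by (meson subset_trans)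
  next
    case one
    have "teq s s (\<Delta> 1) [(1, 1)]"
      by (rule teqI_tapp) (simp add: \<Delta>_one[OF vector_space_field])
    then show ?case
      using alg_gen.one[of s G] by (auto simp: tin_def intro!: exI[of _ "[(1, 1)]"])
  next
    case (add x y)
    then obtain xs ys where xs: "set xs \<subseteq> ?A \<times> ?A" "teq s s (\<Delta> x) xs"
      and ys: "set ys \<subseteq> ?A \<times> ?A" "teq s s (\<Delta> y) ys"
      by (auto simp: tin_def)
    have "teq s s (\<Delta> (x + y)) (xs @ ys)"
    proof (rule teqI_tapp)
      fix \<phi> assume \<phi>: "bilin s s (*) \<phi>"
      show "tapp (\<Delta> (x + y)) \<phi> = tapp (xs @ ys) \<phi>"
        using lin_map_add[OF lin_\<Delta>[OF vector_space_field \<phi> lin_map_id]]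
          teq_tapp[OF vs vector_space_field xs(2) \<phi>] teq_tapp[OF vs vector_space_field ys(2) \<phi>]
        by simp
    qed
    with xs ys show ?case by (auto simp: tin_def intro!: exI[of _ "xs @ ys"])
  next
    case (scale x c)
    then obtain xs where xs: "set xs \<subseteq> ?A \<times> ?A" "teq s s (\<Delta> x) xs"
      by (auto simp: tin_def)
    have "teq s s (\<Delta> (s c x)) (map (\<lambda>(a, b). (s c a, b)) xs)"
    proof (rule teqI_tapp)
      fix \<phi> assume \<phi>: "bilin s s (*) \<phi>"
      show "tapp (\<Delta> (s c x)) \<phi> = tapp (map (\<lambda>(a, b). (s c a, b)) xs) \<phi>"
        using lin_map_scale[OF lin_\<Delta>[OF vector_space_field \<phi> lin_map_id]]
          teq_tapp[OF vs vector_space_field xs(2) \<phi>] lin_map_scale[OF bilin_left[OF \<phi> lin_map_id]]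
        by (simp add: tapp_map flip: tapp_mult_left)
    qed
    moreover have "set (map (\<lambda>(a, b). (s c a, b)) xs) \<subseteq> ?A \<times> ?A"
      using xs(1) by (auto intro!: alg_gen.scale)
    ultimately show ?case unfolding tin_def by (intro exI conjI)
  next
    case (mult x y)
    then obtain xs ys where xs: "set xs \<subseteq> ?A \<times> ?A" "teq s s (\<Delta> x) xs"
      and ys: "set ys \<subseteq> ?A \<times> ?A" "teq s s (\<Delta> y) ys"
      by (auto simp: tin_def)
    let ?zs = "[(a * c, b * d). (a, b) \<leftarrow> xs, (c, d) \<leftarrow> ys]"
    have "teq s s (\<Delta> (x * y)) ?zs"
    proof (rule teqI_tapp)
      fix \<phi> assume \<phi>: "bilin s s (*) \<phi>"
      note lin' = lin bilin_left[OF \<phi>] bilin_right[OF \<phi>]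
      have "tapp (\<Delta> (x * y)) \<phi> = tapp (\<Delta> x) (\<lambda>a b. tapp (\<Delta> y) (\<lambda>c d. \<phi> (a * c) (b * d)))"
        by (rule \<Delta>_mult[OF vector_space_field \<phi>])
      also have "\<dots> = tapp xs (\<lambda>a b. tapp (\<Delta> y) (\<lambda>c d. \<phi> (a * c) (b * d)))"
        by (rule teq_tapp[OF vs vector_space_field xs(2)]) (intro lin')
      also have "\<dots> = tapp xs (\<lambda>a b. tapp ys (\<lambda>c d. \<phi> (a * c) (b * d)))"
        by (intro tapp_cong teq_tapp[OF vs vector_space_field ys(2)] lin')
      also have "\<dots> = tapp ?zs \<phi>"
        by (rule tapp_product[symmetric])
      finally show "tapp (\<Delta> (x * y)) \<phi> = tapp ?zs \<phi>" .
    qed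
    moreover have "set ?zs \<subseteq> ?A \<times> ?A"
      using xs(1) ys(1) by (auto intro!: alg_gen.mult)
    ultimately show ?case unfolding tin_def by (intro exI conjI)
  qed
qed

section \<open>The coefficient coalgebra of degree one and inner-faithfulness\<close>

context frobenius_coaction
begin

text \<open>Nondegeneracy makes the map from \<open>b\<close> to the functional \<open>B _ b\<close>
  injective, and finite dimension makes it surjective.\<close>

lemma functional_representable:
  assumes h: "lin_map sE (*) h"
  shows "\<exists>b. \<forall>e. h e = B e b"
proof -
  obtain Bs where "finite_dimensional_vector_space sE Bs"
    using frobenius by (auto simp: frobenius_form_def)
  then interpret F: finite_dimensional_vector_space sE Bs .
  have coeff: "(\<Sum>v\<in>Bs. sE (c v) v) = 0 \<Longrightarrow> v \<in> Bs \<Longrightarrow> c v = 0" for c v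
    using F.independent_Basis F.independent_explicit by blast
  \<comment> \<open>A functional is encoded by the vector whose coordinates are its values on
    \<open>Bs\<close>. This makes the map into the dual an endomorphism of \<open>E\<close>, to
    which the dimension argument applies.\<close>
  define T where "T b = (\<Sum>v\<in>Bs. sE (B v b) v)" for b
  have "lin_map sE sE T"
    unfolding T_def by (intro lin_map_sum_fun vsE lin_map_scale_vec linE)
  then have T: "Vector_Spaces.linear sE sE T"
    using vsE by (simp add: Vector_Spaces.linear_iff lin_map_def)
  have "inj T"
  proof (subst module_hom.inj_iff_eq_0)
    show "module_hom sE sE T"
      using T by (simp add: module_hom_iff_linear)
    have "b = 0" if "T b = 0" for b
    proof -
      have 0: "B v b = 0" if "v \<in> Bs" for v
        using coeff[OF \<open>T b = 0\<close>[unfolded T_def] that] .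
      have "B a b = 0" for a
        by (rule E.lin_map_eq_on_span[of "(*)" "\<lambda>a. B a b" "\<lambda>_. 0" Bs])
           (use 0 F.span_Basis in \<open>auto intro: lin_B lin_map_id simp: lin_map_def[of _ _ "\<lambda>_. 0"]\<close>)
      then show ?thesis
        using frobenius unfolding frobenius_form_def by blast
    qed
    then show "\<forall>x. T x = 0 \<longrightarrow> x = 0" by blast
  qed
  then have "surj T"
    using F.linear_inj_imp_surj[OF T] by blast
  then obtain b where b: "T b = (\<Sum>v\<in>Bs. sE (h v) v)"
    by (metis surjD)
  have "(\<Sum>v\<in>Bs. sE (h v - B v b) v) = 0"
    using b by (simp add: T_def E.scale_left_diff_distrib sum_subtractf)
  from coeff[OF this] have hB: "h v = B v b" if "v \<in> Bs" for v
    using that by auto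
  have "h e = B e b" for e
    by (rule E.lin_map_eq_on_span[OF h _ hB F.span_Basis]) (intro lin_B lin_map_id)
  then show ?thesis by blast
qed

lemma dual_basis_gr1:
  obtains V b where "finite V" "V \<subseteq> gr 1" "\<forall>e\<in>gr 1. (\<Sum>v\<in>V. sE (B e (b v)) v) = e"
proof -
  obtain Bs where "finite_dimensional_vector_space sE Bs"
    using frobenius by (auto simp: frobenius_form_def)
  then interpret F: finite_dimensional_vector_space sE Bs .
  obtain V where V: "V \<subseteq> gr 1" "E.independent V" "gr 1 \<subseteq> E.span V"
    by (rule E.maximal_independent_subset)
  have fin: "finite V"
    using V(2) by (rule F.finiteI_independent)
  \<comment> \<open>The basis of \<open>gr 1\<close> is extended to all of \<open>E\<close> so that
    its coordinates become functionals on \<open>E\<close>, hence representable by the form.\<close>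
  let ?X = "E.extend_basis V"
  have X: "E.independent ?X" "E.span ?X = UNIV" "V \<subseteq> ?X"
    using V(2) by (auto simp: E.independent_extend_basis E.extend_basis_superset)
  have "\<exists>b. \<forall>e. E.representation ?X e v = B e b" for v
    by (intro functional_representable E.lin_map_representation X)
  then obtain b where b: "\<And>v e. E.representation ?X e v = B e (b v)"
    by metis
  have "(\<Sum>v\<in>V. sE (B e (b v)) v) = e" if "e \<in> gr 1" for e
  proof -
    have "e \<in> E.span V" using V that by blast
    then have "E.representation ?X e = E.representation V e"
      using X by (intro E.representation_extend)
    moreover have "(\<Sum>v\<in>V. sE (E.representation V e v) v) = e"
      using V(2) \<open>e \<in> E.span V\<close> fin by (intro E.sum_representation_eq) auto
    ultimately show ?thesis by (simp flip: b)
  qed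
  with fin V(1) show ?thesis by (intro that) auto
qed

text \<open>Expanding the second factor in the basis collects the first factors into coefficients.
  This is the matrix form of the coaction on \<open>gr 1\<close>.\<close>

lemma \<rho>_expand:
  assumes V: "\<forall>e\<in>gr 1. (\<Sum>v\<in>V. sE (B e (b v)) v) = e"
    and a: "a \<in> gr 1" and t: "vector_space t" and \<phi>: "bilin s sE t \<phi>"
  shows "tapp (\<rho> a) \<phi> = (\<Sum>v\<in>V. \<phi> (coef a (b v)) v)"
proof -
  have "tapp (\<rho> a) \<phi> = tapp (\<rho> a) (\<lambda>k e. \<Sum>v\<in>V. \<phi> (s (B e (b v)) k) v)"
  proof (rule tapp_\<rho>_cong[OF a t \<phi>])
    show "bilin s sE t (\<lambda>k e. \<Sum>v\<in>V. \<phi> (s (B e (b v)) k) v)"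
      by (intro bilinI lin_map_sum_fun t bilin_left[OF \<phi>] linE)
    fix k e assume "e \<in> gr 1"
    have l: "lin_map sE t (\<phi> k)"
      using bilin_right[OF \<phi> lin_map_id] .
    have "\<phi> k e = \<phi> k (\<Sum>v\<in>V. sE (B e (b v)) v)"
      using V \<open>e \<in> gr 1\<close> by simp
    then show "\<phi> k e = (\<Sum>v\<in>V. \<phi> (s (B e (b v)) k) v)"
      by (simp add: lin_map_sum[OF l] lin_map_scale[OF l] lin_map_scale[OF bilin_left[OF \<phi> lin_map_id]])
  qed
  also have "\<dots> = (\<Sum>v\<in>V. \<phi> (coef a (b v)) v)"
    by (simp add: tapp_sum coef_def lin_map_tapp[OF bilin_left[OF \<phi> lin_map_id]])
  finally show ?thesis .
qed

text \<open>Coassociativity trades the coproduct for a second coaction, and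
  \<open>\<rho>_expand\<close> resolves the first one. The result is the comultiplication of a
  matrix coalgebra.\<close>

lemma \<Delta>_coef:
  assumes V: "\<forall>e\<in>gr 1. (\<Sum>v\<in>V. sE (B e (b v)) v) = e"
    and a: "a \<in> gr 1" and t: "vector_space t" and \<phi>: "bilin s s t \<phi>"
  shows "tapp (\<Delta> (coef a c)) \<phi> = (\<Sum>v\<in>V. \<phi> (coef a (b v)) (coef v c))"
proof -
  note lin' = linE t bilin_left[OF \<phi>] bilin_right[OF \<phi>]
  have l: "lin_map s t (\<lambda>x. tapp (\<Delta> x) \<phi>)"
    by (intro lin' \<phi>)
  interpret t: vector_space t by fact
  have "tapp (\<Delta> (coef a c)) \<phi> = tapp (\<rho> a) (\<lambda>k e. tapp (\<Delta> k) (\<lambda>k1 k2. \<phi> k1 (s (B e c) k2)))"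
    by (simp add: coef_def lin_map_tapp[OF l] lin_map_scale[OF l] t.tapp_scale
        lin_map_scale[OF bilin_right[OF \<phi> lin_map_id]])
  also have "\<dots> = tapp (\<rho> a) (\<lambda>k e. tapp (\<rho> e) (\<lambda>l f. \<phi> k (s (B f c) l)))"
    by (rule \<rho>_coassoc[OF t]) (intro lin')+
  also have "\<dots> = (\<Sum>v\<in>V. tapp (\<rho> v) (\<lambda>l f. \<phi> (coef a (b v)) (s (B f c) l)))"
    by (rule \<rho>_expand[OF V a t]) (intro lin')+
  also have "\<dots> = (\<Sum>v\<in>V. \<phi> (coef a (b v)) (coef v c))"
    by (simp add: coef_def lin_map_tapp[OF bilin_right[OF \<phi> lin_map_id]])
  finally show ?thesis .
qed

lemma S_involutive:
  assumes nak: "nakayama B \<mu>" "\<forall>a\<in>gr 1. \<mu> a = sE c a"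
    and inner: "inner_faithful_on s \<Delta> S sE \<rho> (gr 1)"
  shows "S (S x) = x"
proof -
  obtain V b where V: "finite V" "V \<subseteq> gr 1" "\<forall>e\<in>gr 1. (\<Sum>v\<in>V. sE (B e (b v)) v) = e"
    by (rule dual_basis_gr1)
  obtain vs where vs': "set vs = V" "distinct vs"
    using finite_distinct_list[OF V(1)] by blast
  define C where "C = {coef a b | a b. a \<in> gr 1}"
  \<comment> \<open>Adding one round of antipodes makes the set closed under \<open>S\<close>, since
    \<open>S\<close> squared fixes \<open>C\<close>.\<close>
  define G where "G = C \<union> S ` C"
  let ?A = "alg_gen s G"
  have SS: "S (S x) = x" if "x \<in> C" for x
    using that S_S_coef[OF nak] by (auto simp: C_def)
  then have SSG: "S (S x) = x" if "x \<in> G" for x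
    using that by (auto simp: G_def)
  have "hopf_subalgebra s \<Delta> S ?A"
  proof (rule alg_gen_hopf_subalgebra)
    show "S x \<in> G" if "x \<in> G" for x
      using that SS by (auto simp: G_def)
    have C: "\<exists>ys. set ys \<subseteq> C \<times> C \<and> teq s s (\<Delta> x) ys" if x: "x \<in> C" for x
    proof -
      obtain a c where a: "a \<in> gr 1" and x: "x = coef a c"
        using x by (auto simp: C_def)
      have "teq s s (\<Delta> x) (map (\<lambda>v. (coef a (b v), coef v c)) vs)"
        by (rule teqI_tapp)
          (simp add: x \<Delta>_coef[OF V(3) a vector_space_field] tapp_map_list sum_list_distinct_conv_sum_set vs')
      moreover have "set (map (\<lambda>v. (coef a (b v), coef v c)) vs) \<subseteq> C \<times> C"
        using a V(2) vs' by (auto simp: C_def)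
      ultimately show ?thesis by blast
    qed
    show "tin s s (\<Delta> x) G G" if x: "x \<in> G" for x
    proof (cases "x \<in> C")
      case True
      then show ?thesis using C[OF True] unfolding tin_def G_def by blast
    next
      case False
      then obtain y where y: "y \<in> C" "x = S y"
        using x by (auto simp: G_def)
      obtain ys where ys: "set ys \<subseteq> C \<times> C" "teq s s (\<Delta> y) ys"
        using C[OF y(1)] by blast
      have "teq s s (\<Delta> x) (map (\<lambda>(a, b). (S b, S a)) ys)"
      proof (rule teqI_tapp)
        fix \<phi> assume \<phi>: "bilin s s (*) \<phi>"
        have "tapp (\<Delta> x) \<phi> = tapp (\<Delta> y) (\<lambda>a b. \<phi> (S b) (S a))"
          using \<Delta>_S[OF vector_space_field \<phi>] y by simp
        also have "\<dots> = tapp ys (\<lambda>a b. \<phi> (S b) (S a))"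
          by (rule teq_tapp[OF vs vector_space_field ys(2)]) (intro lin bilin_left[OF \<phi>] bilin_right[OF \<phi>])
        finally show "tapp (\<Delta> x) \<phi> = tapp (map (\<lambda>(a, b). (S b, S a)) ys) \<phi>"
          by (simp add: tapp_map)
      qed
      moreover have "set (map (\<lambda>(a, b). (S b, S a)) ys) \<subseteq> G \<times> G"
        using ys(1) by (auto simp: G_def)
      ultimately show ?thesis unfolding tin_def by blast
    qed
  qed
  moreover have "tin s sE (\<rho> a) ?A (gr 1)" if a: "a \<in> gr 1" for a
  proof -
    have "teq s sE (\<rho> a) (map (\<lambda>v. (coef a (b v), v)) vs)"
      by (rule teqI_tapp)
        (simp add: \<rho>_expand[OF V(3) a vector_space_field] tapp_map_list sum_list_distinct_conv_sum_set vs')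
    moreover have "set (map (\<lambda>v. (coef a (b v), v)) vs) \<subseteq> ?A \<times> gr 1"
      using a V(2) vs' by (auto simp: C_def G_def intro!: alg_gen.base)
    ultimately show ?thesis unfolding tin_def by blast
  qed
  ultimately have "?A = UNIV"
    using inner unfolding inner_faithful_on_def by blast
  then have "x \<in> ?A" by simp
  \<comment> \<open>\<open>S\<close> reverses products, so its square is an algebra homomorphism and
    is determined by the generators.\<close>
  then show ?thesis
  proof induction
    case (base x)
    then show ?case by (rule SSG)
  next
    case one
    show ?case by (simp add: S_one)
  next
    case (add x y)
    then show ?case by (simp add: lin_map_add[OF lin_S])
  next
    case (scale x c)
    then show ?case by (simp add: lin_map_scale[OF lin_S])
  next
    case (mult x y)
    then show ?case by (simp add: S_mult)
  qed
qed

end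

section \<open>Integrals and semisimplicity\<close>

context hopf
begin

text \<open>Applying \<open>S\<close> to the right antipode identity reverses the product and
  cancels the double antipode. This is where involutivity enters the semisimplicity
  argument.\<close>

lemma S_right_swapped:
  assumes "\<And>x. S (S x) = x"
  shows "tapp (\<Delta> x) (\<lambda>a b. b * S a) = s (\<epsilon> x) 1"
proof -
  have "S (tapp (\<Delta> x) (\<lambda>a b. a * S b)) = tapp (\<Delta> x) (\<lambda>a b. b * S a)"
    by (simp add: lin_map_tapp[OF lin_S] S_mult assms)
  then show ?thesis
    by (simp add: S_right lin_map_scale[OF lin_S] S_one)
qed

text \<open>The left side is \<open>\<phi>\<close> at \<open>x1 z2 S(z1) \<otimes> x2 z3\<close>;
  coassociativity isolates \<open>z2 S(z1)\<close>, which collapses by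
  \<open>S_right_swapped\<close>.\<close>

lemma \<Delta>_mult_swapped:
  assumes inv: "\<And>x. S (S x) = x" and t: "vector_space t" and \<phi>: "bilin s s t \<phi>"
  shows "tapp (\<Delta> z) (\<lambda>z1 z2. tapp (\<Delta> (x * z2)) (\<lambda>a b. \<phi> (a * S z1) b))
       = tapp (\<Delta> x) (\<lambda>a b. \<phi> a (b * z))"
proof -
  interpret t: vector_space t by fact
  note lin' = lin t bilin_left[OF \<phi>] bilin_right[OF \<phi>]
  have "tapp (\<Delta> z) (\<lambda>z1 z2. tapp (\<Delta> (x * z2)) (\<lambda>a b. \<phi> (a * S z1) b))
    = tapp (\<Delta> z) (\<lambda>z1 z2. tapp (\<Delta> x) (\<lambda>a b. tapp (\<Delta> z2) (\<lambda>c d. \<phi> (a * c * S z1) (b * d))))"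
  proof (rule tapp_cong)
    fix z1 z2
    show "tapp (\<Delta> (x * z2)) (\<lambda>a b. \<phi> (a * S z1) b)
      = tapp (\<Delta> x) (\<lambda>a b. tapp (\<Delta> z2) (\<lambda>c d. \<phi> (a * c * S z1) (b * d)))"
      by (rule \<Delta>_mult[OF t]) (intro lin')
  qed
  also have "\<dots> = tapp (\<Delta> x) (\<lambda>a b. tapp (\<Delta> z) (\<lambda>z1 z2. tapp (\<Delta> z2) (\<lambda>c d. \<phi> (a * (c * S z1)) (b * d))))"
    by (subst tapp_swap) (simp add: mult.assoc)
  also have "\<dots> = tapp (\<Delta> x) (\<lambda>a b. \<phi> a (b * z))"
  proof (rule tapp_cong)
    fix a b
    have "tapp (\<Delta> z) (\<lambda>z1 z2. tapp (\<Delta> z2) (\<lambda>c d. \<phi> (a * (c * S z1)) (b * d)))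
      = tapp (\<Delta> z) (\<lambda>u d. tapp (\<Delta> u) (\<lambda>z1 c. \<phi> (a * (c * S z1)) (b * d)))"
      by (rule \<Delta>_coassoc[OF t, symmetric]) (intro lin')+
    also have "\<dots> = tapp (\<Delta> z) (\<lambda>u d. t (\<epsilon> u) (\<phi> a (b * d)))"
    proof (rule tapp_cong)
      fix u d
      have l: "lin_map s t (\<lambda>y. \<phi> (a * y) (b * d))"
        by (intro lin')
      show "tapp (\<Delta> u) (\<lambda>z1 c. \<phi> (a * (c * S z1)) (b * d)) = t (\<epsilon> u) (\<phi> a (b * d))"
        using lin_map_tapp[OF l, of "\<Delta> u" "\<lambda>z1 c. c * S z1"] lin_map_scale[OF l, of _ 1]
        by (simp add: S_right_swapped[OF inv])
    qed
    also have "\<dots> = \<phi> a (b * z)"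
      by (intro counit_left lin')
    finally show "tapp (\<Delta> z) (\<lambda>z1 z2. tapp (\<Delta> z2) (\<lambda>c d. \<phi> (a * (c * S z1)) (b * d))) = \<phi> a (b * z)" .
  qed
  finally show ?thesis .
qed

definition regular_character :: "'K set \<Rightarrow> 'K \<Rightarrow> 'k" where
  "regular_character Bs x = (\<Sum>v\<in>Bs. representation Bs (x * v) v)"

text \<open>Cyclicity of the trace moves \<open>x z\<^sub>2\<close> past the coproduct of the basis vector \<open>z\<close>
  and leaves \<open>z\<^sub>1 S(z\<^sub>2)\<close>, which collapses.\<close>

lemma regular_character_integral:
  assumes inv: "\<And>x. S (S x) = x"
    and Bs: "finite Bs" "independent Bs" "span Bs = UNIV"
  shows "tapp (\<Delta> x) (\<lambda>a b. s (regular_character Bs b) a) = s (regular_character Bs x) 1"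
proof -
  define r where "r i v = representation Bs v i" for i v
  have lin_r: "lin_map q (*) (\<lambda>x. r i (f x))" if "lin_map q s f" for q i f
    using lin_map_compose[OF lin_map_representation[OF Bs(2,3)] that] by (simp add: r_def)
  have expand: "f v = (\<Sum>i\<in>Bs. t (r i v) (f i))" if f: "lin_map s t f" for v t and f :: "'K \<Rightarrow> 'K"
  proof -
    have "v = (\<Sum>i\<in>Bs. s (r i v) i)"
      unfolding r_def using Bs by (intro sum_representation_eq[symmetric]) auto
    then have "f v = f (\<Sum>i\<in>Bs. s (r i v) i)" by simp
    then show ?thesis by (simp add: lin_map_sum[OF f] lin_map_scale[OF f])
  qed
  have "tapp (\<Delta> x) (\<lambda>a b. s (regular_character Bs b) a)
      = (\<Sum>i\<in>Bs. tapp (\<Delta> x) (\<lambda>a b. s (r i (b * i)) a))"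
    by (simp add: regular_character_def scale_sum_left tapp_sum r_def)
  \<comment> \<open>Read backwards, \<open>\<Delta>_mult_swapped\<close> lets \<open>x\<close> enter
    only through the product \<open>x * z2\<close>, which can be moved as a whole.\<close>
  also have "\<dots> = (\<Sum>i\<in>Bs. tapp (\<Delta> i) (\<lambda>z1 z2. tapp (\<Delta> (x * z2)) (\<lambda>a b. s (r i b) (a * S z1))))"
    by (intro sum.cong refl \<Delta>_mult_swapped[OF inv vs, symmetric] lin lin_r)
  \<comment> \<open>The vector \<open>x * z2\<close> is expanded in a second copy of the basis,
    indexed by \<open>j\<close>.\<close>
  also have "\<dots> = (\<Sum>i\<in>Bs. \<Sum>j\<in>Bs. tapp (\<Delta> i) (\<lambda>z1 z2. s (r j (x * z2)) (tapp (\<Delta> j) (\<lambda>a b. s (r i b) (a * S z1)))))"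
  proof -
    have "tapp (\<Delta> (x * z2)) (\<lambda>a b. s (r i b) (a * S z1))
      = (\<Sum>j\<in>Bs. s (r j (x * z2)) (tapp (\<Delta> j) (\<lambda>a b. s (r i b) (a * S z1))))" for i z1 z2
      by (rule expand) (intro lin lin_r)
    then show ?thesis by (simp add: tapp_sum)
  qed
  also have "\<dots> = (\<Sum>j\<in>Bs. tapp (\<Delta> j) (\<lambda>a b. \<Sum>i\<in>Bs. s (r i b) (tapp (\<Delta> i) (\<lambda>z1 z2. s (r j (x * z2)) (a * S z1)))))"
  proof -
    have "tapp (\<Delta> i) (\<lambda>z1 z2. s (r j (x * z2)) (tapp (\<Delta> j) (\<lambda>a b. s (r i b) (a * S z1))))
      = tapp (\<Delta> j) (\<lambda>a b. s (r i b) (tapp (\<Delta> i) (\<lambda>z1 z2. s (r j (x * z2)) (a * S z1))))" for i j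
      unfolding tapp_scale by (subst tapp_swap) (simp add: mult.commute)
    then show ?thesis by (subst sum.swap) (simp add: tapp_sum)
  qed
  \<comment> \<open>Summing over \<open>i\<close> instead reassembles \<open>b\<close>; together
    with the exchange of sums this is the cyclicity of the trace.\<close>
  also have "\<dots> = (\<Sum>j\<in>Bs. tapp (\<Delta> j) (\<lambda>a b. tapp (\<Delta> b) (\<lambda>z1 z2. s (r j (x * z2)) (a * S z1))))"
    by (intro sum.cong refl tapp_cong expand[symmetric] lin lin_r)
  also have "\<dots> = (\<Sum>j\<in>Bs. tapp (\<Delta> j) (\<lambda>u z. tapp (\<Delta> u) (\<lambda>a z1. s (r j (x * z)) (a * S z1))))"
    by (intro sum.cong refl \<Delta>_coassoc[OF vs, symmetric] lin lin_r)
  also have "\<dots> = (\<Sum>j\<in>Bs. tapp (\<Delta> j) (\<lambda>u z. s (\<epsilon> u) (s (r j (x * z)) 1)))"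
    by (simp add: S_right mult.commute flip: tapp_scale)
  also have "\<dots> = (\<Sum>j\<in>Bs. s (r j (x * j)) 1)"
    by (intro sum.cong refl counit_left lin lin_r)
  also have "\<dots> = s (regular_character Bs x) 1"
    by (simp add: regular_character_def r_def scale_sum_left)
  finally show ?thesis .
qed

lemma regular_character_one:
  assumes "independent Bs"
  shows "regular_character Bs 1 = of_nat (card Bs)"
  using assms by (simp add: regular_character_def representation_basis)

lemma lin_regular_character:
  assumes "independent Bs" "span Bs = UNIV"
  shows "lin_map s (*) (regular_character Bs)"
  unfolding regular_character_def
  by (intro lin_map_sum_fun vector_space_field lin_map_compose[OF lin_map_representation[OF assms]] lin)

section \<open>Averaging over an integral\<close>

text \<open>The integral equation at \<open>a * S b\<close>, paired with the functional
  \<open>g (p * c)\<close> of \<open>p\<close>, gives \<open>t(a2 S(b1)) g(a1 S(b2) c)\<close>; here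
  \<open>b\<close> and \<open>c\<close> come from \<open>y\<close>, so \<open>S(b2) c\<close>
  collapses. The identity is what makes the averaged projection commute with convolution.\<close>

lemma integral_conv:
  assumes t: "lin_map s (*) t" "\<And>x. tapp (\<Delta> x) (\<lambda>a b. s (t b) a) = s (t x) 1"
    and g: "lin_map s (*) g"
  shows "tapp (\<Delta> y) (\<lambda>b c. t (a * S b) * g c) = tapp (\<Delta> a) (\<lambda>a1 a2. g a1 * t (a2 * S y))"
proof -
  note lin' = lin lin_map_compose[OF t(1)] lin_map_compose[OF g]
  have int: "t x * h 1 = tapp (\<Delta> x) (\<lambda>p q. t q * h p)" if h: "lin_map s (*) h" for x h
  proof -
    have "h (s (t x) 1) = h (tapp (\<Delta> x) (\<lambda>a b. s (t b) a))"
      by (simp add: t(2))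
    then show ?thesis
      by (simp add: lin_map_tapp[OF h] lin_map_scale[OF h])
  qed
  have "tapp (\<Delta> y) (\<lambda>b c. t (a * S b) * g c)
      = tapp (\<Delta> y) (\<lambda>b c. tapp (\<Delta> b) (\<lambda>b1 b2. tapp (\<Delta> a) (\<lambda>a1 a2. t (a2 * S b1) * g (a1 * (S b2 * c)))))"
  proof (rule tapp_cong)
    fix b c
    have "t (a * S b) * g c = tapp (\<Delta> (a * S b)) (\<lambda>p q. t q * g (p * c))"
      using int[of "\<lambda>p. g (p * c)" "a * S b"] by (simp add: lin')
    also have "\<dots> = tapp (\<Delta> a) (\<lambda>a1 a2. tapp (\<Delta> (S b)) (\<lambda>p q. t (a2 * q) * g (a1 * p * c)))"
      by (rule \<Delta>_mult[OF vector_space_field]) (intro lin')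
    also have "\<dots> = tapp (\<Delta> a) (\<lambda>a1 a2. tapp (\<Delta> b) (\<lambda>b1 b2. t (a2 * S b1) * g (a1 * S b2 * c)))"
      by (intro tapp_cong \<Delta>_S[OF vector_space_field] lin')
    also have "\<dots> = tapp (\<Delta> b) (\<lambda>b1 b2. tapp (\<Delta> a) (\<lambda>a1 a2. t (a2 * S b1) * g (a1 * (S b2 * c))))"
      by (subst tapp_swap) (simp add: mult.assoc)
    finally show "t (a * S b) * g c
      = tapp (\<Delta> b) (\<lambda>b1 b2. tapp (\<Delta> a) (\<lambda>a1 a2. t (a2 * S b1) * g (a1 * (S b2 * c))))" .
  qed
  also have "\<dots> = tapp (\<Delta> y) (\<lambda>b1 u. tapp (\<Delta> u) (\<lambda>b2 c. tapp (\<Delta> a) (\<lambda>a1 a2. t (a2 * S b1) * g (a1 * (S b2 * c)))))"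
    by (rule \<Delta>_coassoc[OF vector_space_field]) (intro lin')+
  also have "\<dots> = tapp (\<Delta> y) (\<lambda>b1 u. \<epsilon> u * tapp (\<Delta> a) (\<lambda>a1 a2. t (a2 * S b1) * g a1))"
  proof (rule tapp_cong)
    fix b1 u
    have l: "lin_map s (*) (\<lambda>w. tapp (\<Delta> a) (\<lambda>a1 a2. t (a2 * S b1) * g (a1 * w)))"
      by (intro lin')
    show "tapp (\<Delta> u) (\<lambda>b2 c. tapp (\<Delta> a) (\<lambda>a1 a2. t (a2 * S b1) * g (a1 * (S b2 * c))))
        = \<epsilon> u * tapp (\<Delta> a) (\<lambda>a1 a2. t (a2 * S b1) * g a1)"
      using lin_map_tapp[OF l, of "\<Delta> u" "\<lambda>b2 c. S b2 * c"] lin_map_scale[OF l, of _ 1]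
      by (simp add: S_left)
  qed
  also have "\<dots> = tapp (\<Delta> a) (\<lambda>a1 a2. t (a2 * S y) * g a1)"
    by (intro counit_right lin')
  finally show ?thesis by (simp add: mult.commute)
qed

lemma dual_left_ideal_sum:
  assumes "dual_left_ideal s \<Delta> L" "\<And>i. i \<in> I \<Longrightarrow> f i \<in> L"
  shows "(\<lambda>x. \<Sum>i\<in>I. f i x) \<in> L"
  using assms by (induction I rule: infinite_finite_induct) (auto simp: dual_left_ideal_def)

lemma maschke:
  assumes t: "lin_map s (*) t" "\<And>x. tapp (\<Delta> x) (\<lambda>a b. s (t b) a) = s (t x) 1" "t 1 = 1"
    and Bs: "finite Bs" "independent Bs" "span Bs = UNIV"
  shows "dual_semisimple s \<Delta>"
  unfolding dual_semisimple_def
proof (intro allI impI)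
  fix L assume L: "dual_left_ideal s \<Delta> L"
  \<comment> \<open>The ambient space consists of all functions on \<open>K\<close>, which makes the
    projection \<open>p\<close> total. Its values are linear because they lie in
    \<open>L\<close>.\<close>
  define sF :: "'k \<Rightarrow> ('K \<Rightarrow> 'k) \<Rightarrow> ('K \<Rightarrow> 'k)" where "sF c f = (\<lambda>x. c * f x)" for c f
  interpret F: vector_space sF
    by unfold_locales (auto simp: sF_def fun_eq_iff algebra_simps)
  have L_lin: "lin_map s (*) f" if "f \<in> L" for f
    using L that by (auto simp: dual_left_ideal_def dual_elems_def lin_fun_iff_lin_map)
  have L_conv: "(\<lambda>x. tapp (\<Delta> x) (\<lambda>a b. g a * f b)) \<in> L" if "f \<in> L" "lin_map s (*) g" for f g
    using L that unfolding dual_left_ideal_def dual_elems_def lin_fun_iff_lin_map conv_def teval_eq_tapp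
    by blast
  have "F.subspace L"
    using L by (auto simp: F.subspace_def dual_left_ideal_def sF_def plus_fun_def zero_fun_def)
  then obtain p where p: "lin_map sF sF p" "\<And>f. p f \<in> L" "\<And>f. f \<in> L \<Longrightarrow> p f = f"
    by (rule F.subspace_projection) blast
  \<comment> \<open>\<open>P\<close> is the average \<open>t\<^sub>1 * p (S(t\<^sub>2) * f)\<close> of \<open>p\<close> over the integral \<open>t\<close> of the dual,
    with the coproduct of \<open>t\<close> evaluated as \<open>t (a b)\<close>.\<close>
  define Q where "Q f a = (\<lambda>y. tapp (\<Delta> y) (\<lambda>b c. t (a * S b) * f c))" for f a
  define P where "P f = (\<lambda>x. tapp (\<Delta> x) (\<lambda>a z. p (Q f a) z))" for f
  have lin_eval: "lin_map sF (*) (\<lambda>f. p f z)" for z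
    using p(1) by (auto simp: lin_map_def sF_def)
  have lin_Q: "lin_map s sF (Q f)" for f
  proof -
    have "lin_map s (*) (\<lambda>a. Q f a y)" for y
      unfolding Q_def by (intro lin lin_map_compose[OF t(1)])
    then show ?thesis by (auto simp: lin_map_def sF_def fun_eq_iff)
  qed
  have Q_lin: "lin_map sF sF (\<lambda>f. Q f a)" for a
    by (auto simp: lin_map_def sF_def Q_def fun_eq_iff tapp_mult_left algebra_simps tapp_add)
  have P_lin: "lin_map sF sF P"
  proof -
    have "lin_map sF (*) (\<lambda>f. P f x)" for x
      unfolding P_def by (intro lin_map_tapp_fun vector_space_field lin_map_compose[OF lin_eval Q_lin])
    then show ?thesis by (auto simp: lin_map_def sF_def fun_eq_iff)
  qed
  \<comment> \<open>Expanding the first tensor factor in the finite basis writes \<open>P f\<close>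
    as a finite sum of convolutions with elements of \<open>L\<close>.\<close>
  have P_L: "P f \<in> L" for f
  proof -
    define r where "r i v = representation Bs v i" for i v
    have lin_r: "lin_map s (*) (r i)" for i
      using lin_map_representation[OF Bs(2,3)] by (simp add: r_def[abs_def])
    have "P f x = (\<Sum>i\<in>Bs. tapp (\<Delta> x) (\<lambda>a z. r i a * p (Q f i) z))" for x
    proof -
      have "p (Q f a) z = (\<Sum>i\<in>Bs. r i a * p (Q f i) z)" for a z
      proof -
        have l: "lin_map s (*) (\<lambda>a. p (Q f a) z)"
          by (rule lin_map_compose[OF lin_eval lin_Q])
        have "a = (\<Sum>i\<in>Bs. s (r i a) i)"
          unfolding r_def using Bs by (intro sum_representation_eq[symmetric]) auto
        then have "p (Q f a) z = p (Q f (\<Sum>i\<in>Bs. s (r i a) i)) z" by simp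
        then show ?thesis by (simp add: lin_map_sum[OF l] lin_map_scale[OF l])
      qed
      then show ?thesis unfolding P_def tapp_sum[symmetric] by (intro tapp_cong)
    qed
    then have "P f = (\<lambda>x. \<Sum>i\<in>Bs. tapp (\<Delta> x) (\<lambda>a z. r i a * p (Q f i) z))"
      by blast
    then show ?thesis
      by (simp only:) (intro dual_left_ideal_sum[OF L] L_conv p lin_r)
  qed
  \<comment> \<open>Each \<open>Q f a\<close> is a convolution with \<open>f\<close>, hence in
    \<open>L\<close> and fixed by \<open>p\<close>. Then \<open>a * S b\<close> collapses and
    \<open>t 1 = 1\<close> removes the average.\<close>
  have P_id: "P f = f" if f: "f \<in> L" for f
  proof
    fix x
    note lin' = lin lin_map_compose[OF t(1)] lin_map_compose[OF L_lin[OF f]]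
    have "Q f a \<in> L" for a
      unfolding Q_def by (intro L_conv f lin')
    then have "P f x = tapp (\<Delta> x) (\<lambda>a z. tapp (\<Delta> z) (\<lambda>b c. t (a * S b) * f c))"
      by (simp add: P_def p(3)) (simp add: Q_def[abs_def])
    also have "\<dots> = tapp (\<Delta> x) (\<lambda>u c. tapp (\<Delta> u) (\<lambda>a b. t (a * S b) * f c))"
      by (rule \<Delta>_coassoc[OF vector_space_field, symmetric]) (intro lin')+
    also have "\<dots> = tapp (\<Delta> x) (\<lambda>u c. \<epsilon> u * f c)"
    proof (rule tapp_cong)
      fix u c
      have "tapp (\<Delta> u) (\<lambda>a b. t (a * S b)) = \<epsilon> u"
        using lin_map_tapp[OF t(1), of "\<Delta> u" "\<lambda>a b. a * S b"]
        by (simp add: S_right lin_map_scale[OF t(1)] t(3))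
      then show "tapp (\<Delta> u) (\<lambda>a b. t (a * S b) * f c) = \<epsilon> u * f c"
        by (simp flip: tapp_mult_right)
    qed
    also have "\<dots> = f x"
      by (intro counit_left L_lin f)
    finally show "P f x = f x" .
  qed
  have P_conv: "P (\<lambda>x. tapp (\<Delta> x) (\<lambda>a b. g a * f b)) = (\<lambda>x. tapp (\<Delta> x) (\<lambda>a b. g a * P f b))"
    if g: "lin_map s (*) g" and f: "lin_map s (*) f" for g f
  proof
    fix x
    note lin' = lin lin_map_compose[OF t(1)] lin_map_compose[OF g] lin_map_compose[OF f]
    let ?gf = "\<lambda>x. tapp (\<Delta> x) (\<lambda>a b. g a * f b)"
    \<comment> \<open>By \<open>integral_conv\<close> the factor \<open>g\<close> moves from the
      argument of \<open>p\<close> to a coefficient depending on \<open>a\<close> alone, so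
      linearity carries it through \<open>p\<close>.\<close>
    have Q: "Q ?gf a = tapp (\<Delta> a) (\<lambda>a1 a2. sF (g a1) (Q f a2))" for a
    proof
      fix y
      have eval: "tapp xs \<phi> y = tapp xs (\<lambda>a b. \<phi> a b y)" for xs and \<phi> :: "'K \<Rightarrow> 'K \<Rightarrow> 'K \<Rightarrow> 'k"
        by (induction xs) auto
      have "Q ?gf a y = tapp (\<Delta> y) (\<lambda>b u. tapp (\<Delta> u) (\<lambda>c d. t (a * S b) * g c * f d))"
        by (simp add: Q_def tapp_mult_left mult.assoc)
      also have "\<dots> = tapp (\<Delta> y) (\<lambda>u d. tapp (\<Delta> u) (\<lambda>b c. t (a * S b) * g c * f d))"
        by (rule \<Delta>_coassoc[OF vector_space_field, symmetric]) (intro lin')+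
      also have "\<dots> = tapp (\<Delta> y) (\<lambda>u d. tapp (\<Delta> a) (\<lambda>a1 a2. g a1 * t (a2 * S u)) * f d)"
        by (simp add: integral_conv[OF t(1,2) g] flip: tapp_mult_right)
      also have "\<dots> = tapp (\<Delta> a) (\<lambda>a1 a2. g a1 * Q f a2 y)"
        unfolding Q_def tapp_mult_right tapp_mult_left by (subst tapp_swap) (simp add: mult.assoc)
      finally show "Q ?gf a y = tapp (\<Delta> a) (\<lambda>a1 a2. sF (g a1) (Q f a2)) y"
        by (simp add: eval sF_def)
    qed
    have "P ?gf x = tapp (\<Delta> x) (\<lambda>a z. tapp (\<Delta> a) (\<lambda>a1 a2. g a1 * p (Q f a2) z))"
      by (simp add: P_def Q lin_map_tapp[OF lin_eval] lin_map_scale[OF lin_eval])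
    also have "\<dots> = tapp (\<Delta> x) (\<lambda>a b. tapp (\<Delta> b) (\<lambda>a2 z. g a * p (Q f a2) z))"
      by (rule \<Delta>_coassoc[OF vector_space_field])
        (intro lin' lin_map_compose[OF lin_eval lin_Q] L_lin p)+
    also have "\<dots> = tapp (\<Delta> x) (\<lambda>a b. g a * P f b)"
      by (simp add: P_def tapp_mult_left)
    finally show "P ?gf x = tapp (\<Delta> x) (\<lambda>a b. g a * P f b)" .
  qed
  \<comment> \<open>The complement is the kernel of \<open>P\<close> within the linear functionals;
    it is a left ideal by \<open>P_conv\<close>.\<close>
  define L' where "L' = {f. lin_map s (*) f \<and> P f = (\<lambda>_. 0)}"
  have P_add: "P (\<lambda>x. f x + g x) = (\<lambda>x. P f x + P g x)"
    and P_scale: "P (\<lambda>x. c * f x) = (\<lambda>x. c * P f x)" for f g c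
    using lin_map_add[OF P_lin, of f g] lin_map_scale[OF P_lin, of c f]
    by (simp_all add: plus_fun_def sF_def)
  have "dual_left_ideal s \<Delta> L'"
    unfolding dual_left_ideal_def
  proof (intro conjI ballI allI)
    show "L' \<subseteq> dual_elems s"
      by (auto simp: L'_def dual_elems_def lin_fun_iff_lin_map)
    have "(\<lambda>_. 0) \<in> L"
      using L by (auto simp: dual_left_ideal_def)
    then show "(\<lambda>_. 0) \<in> L'"
      using L_lin P_id by (auto simp: L'_def)
    show "(\<lambda>x. f x + g x) \<in> L'" if "f \<in> L'" "g \<in> L'" for f g
      using that by (auto simp: L'_def P_add intro: lin_map_plus vector_space_field)
    show "(\<lambda>x. c * f x) \<in> L'" if "f \<in> L'" for c f
      using that by (auto simp: L'_def P_scale intro: lin_map_field_mult)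
    show "conv \<Delta> g f \<in> L'" if "g \<in> dual_elems s" "f \<in> L'" for g f
    proof -
      have gf: "lin_map s (*) g" "lin_map s (*) f" "P f = (\<lambda>_. 0)"
        using that by (auto simp: L'_def dual_elems_def lin_fun_iff_lin_map)
      have "lin_map s (*) (\<lambda>x. tapp (\<Delta> x) (\<lambda>a b. g a * f b))"
        by (intro lin lin_map_compose[OF gf(1)] lin_map_compose[OF gf(2)])
      then show ?thesis
        by (simp add: L'_def conv_def teval_eq_tapp P_conv gf tapp_zero)
    qed
  qed
  moreover have "L \<inter> L' = {\<lambda>_. 0}"
  proof
    show "L \<inter> L' \<subseteq> {\<lambda>_. 0}"
      using P_id by (auto simp: L'_def)
    show "{\<lambda>_. 0} \<subseteq> L \<inter> L'"
      using L \<open>dual_left_ideal s \<Delta> L'\<close> by (auto simp: dual_left_ideal_def)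
  qed
  moreover have "\<exists>a\<in>L. \<exists>b\<in>L'. f = (\<lambda>x. a x + b x)" if f: "f \<in> dual_elems s" for f
  proof (intro bexI)
    \<comment> \<open>This is \<open>f\<close> minus \<open>P f\<close>, written so that
      \<open>P_add\<close> and \<open>P_scale\<close> apply; \<open>P\<close> kills it because it
      fixes \<open>P f\<close>.\<close>
    let ?b = "\<lambda>x. f x + (- 1) * P f x"
    show "P f \<in> L" by (rule P_L)
    show "f = (\<lambda>x. P f x + ?b x)" by simp
    have "lin_map s (*) f"
      using f by (simp add: dual_elems_def lin_fun_iff_lin_map)
    then have "lin_map s (*) ?b"
      by (intro lin_map_plus vector_space_field lin_map_field_mult L_lin[OF P_L])
    moreover have "P ?b = (\<lambda>_. 0)"
      unfolding P_add P_scale P_id[OF P_L] by simp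
    ultimately show "?b \<in> L'" by (simp add: L'_def)
  qed
  ultimately show "\<exists>L'. dual_left_ideal s \<Delta> L' \<and> L \<inter> L' = {\<lambda>_. 0} \<and>
      (\<forall>f\<in>dual_elems s. \<exists>a\<in>L. \<exists>b\<in>L'. f = (\<lambda>x. a x + b x))"
    by blast
qed

lemma dual_semisimple_if_involutive:
  assumes inv: "\<And>x. S (S x) = x"
    and fin: "finite_dimensional_vector_space s Bs"
    and char: "\<not> CHAR('k) dvd dim UNIV"
  shows "dual_semisimple s \<Delta>"
proof -
  interpret F: finite_dimensional_vector_space s Bs by fact
  note Bs = F.finite_Basis F.independent_Basis F.span_Basis
  \<comment> \<open>The dimension of \<open>K\<close> as an element of the field, which is the value
    of the regular character at the unit. Dividing by it normalizes the integral.\<close>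
  define n where "n = (of_nat (card Bs) :: 'k)"
  have n: "n \<noteq> 0"
    using char by (simp add: n_def of_nat_eq_0_iff_char_dvd)
  let ?\<chi> = "regular_character Bs"
  show ?thesis
  proof (rule maschke[OF _ _ _ Bs])
    show "lin_map s (*) (\<lambda>x. inverse n * ?\<chi> x)"
      by (intro lin_map_field_mult lin_regular_character Bs)
    show "inverse n * ?\<chi> 1 = 1"
      using n by (simp add: regular_character_one[OF Bs(2)] n_def)
    show "tapp (\<Delta> x) (\<lambda>a b. s (inverse n * ?\<chi> b) a) = s (inverse n * ?\<chi> x) 1" for x
      by (simp add: regular_character_integral[OF inv Bs] flip: scale_scale tapp_scale)
  qed
qed

end

theorem theorem3p3:
  fixes sK :: "'k::field \<Rightarrow> 'K::ring_1 \<Rightarrow> 'K"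
    and \<Delta> :: "'K \<Rightarrow> ('K \<times> 'K) list" and \<epsilon> :: "'K \<Rightarrow> 'k" and S :: "'K \<Rightarrow> 'K"
    and sE :: "'k \<Rightarrow> 'E::ring_1 \<Rightarrow> 'E" and gr :: "nat \<Rightarrow> 'E set"
    and B :: "'E \<Rightarrow> 'E \<Rightarrow> 'k" and \<mu> :: "'E \<Rightarrow> 'E"
    and \<rho> :: "'E \<Rightarrow> ('K \<times> 'E) list"
  assumes E_graded: "connected_graded sE gr"
    and E_frob: "frobenius_form sE gr B"
    and nak: "nakayama B \<mu>"
    and nak_scalar: "\<exists>c. \<forall>a\<in>gr 1. \<mu> a = sE c a"
    and K_hopf: "hopf_algebra sK \<Delta> \<epsilon> S"
    and comod: "graded_comodule_algebra sK \<Delta> \<epsilon> sE gr \<rho>"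
    and inner: "inner_faithful_on sK \<Delta> S sE \<rho> (gr 1)"
    and codet: "codeterminant_trivial sK sE gr \<rho>"
  shows "(\<forall>x. S (S x) = x) \<and>
         ((\<exists>Bas. finite_dimensional_vector_space sK Bas) \<and>
          \<not> CHAR('k) dvd vector_space.dim sK UNIV \<longrightarrow> dual_semisimple sK \<Delta>)"
proof -
  interpret frobenius_coaction sK \<Delta> \<epsilon> S sE gr B \<rho>
    using E_graded E_frob K_hopf comod codet by unfold_locales
  have "S (S x) = x" for x
    using nak_scalar S_involutive[OF nak _ inner] by blast
  then show ?thesis
    using dual_semisimple_if_involutive by blast
qed

end
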